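(* For each type of nonempty topological space $(X,\mathcal T)$, the set of values of $k(X,\mathcal T)$, respectively of $k_f(X,\mathcal T)$, attained by spaces of that type is exactly: - GE: $k\in\{8,10,12,14\}$; $k_f\in\{10\}\cup\{14,16,18,20,22,24,26,28,30,32,34\}$; - KD: $k\in\{10,12,14\}$; $k_f\in\{18,22,28\}$; - ED: $k\in\{4,6,8,10\}$; $k_f\in\{4,6,8,10,16,22\}$; - OU: $k\in\{4,6,8,10\}$; $k_f\in\{8,10,14,16,20\}$; - EO: $k\in\{4,6,8\}$; $k_f\in\{4,6,8,10,16\}$; - partition: $k\in\{4,6\}$; $k_f\in\{4,6,10\}$; - discrete: $k\in\{2\}$; $k_f\in\{2,4\}$.
   Context: Set operators on $X\ne\varnothing$ are maps $2^X\to2^X$; products are compositions, $(o_1o_2)A=o_1(o_2A)$. Let $a$ be complement, $b$ closure, $i=aba$ interior, $f$ boundary ($fA=bA\cap b(aA)$), $\mathrm{id}$ the identity operator, $0A=\varnothing$. Put $\mathbf K^0=\{\mathrm{id},b,i,bi,ib,bib,ibi\}$, $\mathbf F^0=\{0,f,if,fif,bif,ff,fb,fi,fbi,fib\}$, $\mathbf K=\mathbf K^0\cup a\mathbf K^0$, $\mathbf{KF}=(\mathbf K^0\cup\mathbf F^0)\cup a(\mathbf K^0\cup\mathbf F^0)$; $|\mathbf K|,|\mathbf{KF}|$ denote the number of distinct operators on $2^X$ in these sets. For $A\subseteq X$ let $k(A)=|\{oA:o\in\mathbf K\}|$ and $k_f(A)=|\{oA:o\in\mathbf{KF}\}|$;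 let $k(X,\mathcal T)=\max_{A\subseteq X}k(A)$ and $k_f(X,\mathcal T)=\max_{A\subseteq X}k_f(A)$. Types of spaces. Let $S=\{o\in\{ib,bi,b\}: o=bib \text{ as operators on } 2^X\}$. The space is Kuratowski if $S=\varnothing$ (equivalently $|\mathbf K|=14$), ED if $S=\{ib\}$, OU if $S=\{bi\}$, EO if $S=\{ib,bi\}$, partition if $S=\{ib,b\}$, discrete if $S=\{ib,bi,b\}$; these are the only possibilities. A Kuratowski space is KD (Kuratowski disconnected) if $ifA$ is clopen for every $A\subseteq X$ (equivalently $|\mathbf{KF}|=28$), and GE otherwise (equivalently $|\mathbf{KF}|=34$). *)

theory Defs
  imports "HOL-Analysis.Analysis"
begin

text \<open>
  A set operator on a space \<open>X\<close> is represented by a function on all sets over the point type, but it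
  is only ever applied to, and compared on, subsets of \<^term>\<open>topspace X\<close>.
\<close>

type_synonym 'a set_op = "'a set \<Rightarrow> 'a set"

definition cmp :: "'a topology \<Rightarrow> 'a set_op" where
  "cmp X A = topspace X - A"

definition cl :: "'a topology \<Rightarrow> 'a set_op" where
  "cl X A = X closure_of A"

definition int_op :: "'a topology \<Rightarrow> 'a set_op" where
  "int_op X = cmp X \<circ> cl X \<circ> cmp X"

definition bd :: "'a topology \<Rightarrow> 'a set_op" where
  "bd X A = cl X A \<inter> cl X (cmp X A)"

definition zero_op :: "'a set_op" where
  "zero_op A = {}"

lemma int_op_eq_interior_of: "A \<subseteq> topspace X \<Longrightarrow> int_op X A = X interior_of A"
  by (simp add: int_op_def cmp_def cl_def interior_of_closure_of)

lemma bd_eq_frontier_of: "A \<subseteq> topspace X \<Longrightarrow> bd X A = X frontier_of A"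
  by (simp add: bd_def cmp_def cl_def frontier_of_closures)

definition K0 :: "'a topology \<Rightarrow> 'a set_op set" where
  "K0 X = (let b = cl X; i = int_op X in
     {id, b, i, b \<circ> i, i \<circ> b, b \<circ> i \<circ> b, i \<circ> b \<circ> i})"

definition F0 :: "'a topology \<Rightarrow> 'a set_op set" where
  "F0 X = (let b = cl X; i = int_op X; f = bd X in
     {zero_op, f, i \<circ> f, f \<circ> i \<circ> f, b \<circ> i \<circ> f, f \<circ> f, f \<circ> b, f \<circ> i, f \<circ> b \<circ> i, f \<circ> i \<circ> b})"

definition K_ops :: "'a topology \<Rightarrow> 'a set_op set" where
  "K_ops X = K0 X \<union> (\<lambda>p. cmp X \<circ> p) ` K0 X"

definition KF_ops :: "'a topology \<Rightarrow> 'a set_op set" where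
  "KF_ops X = (K0 X \<union> F0 X) \<union> (\<lambda>p. cmp X \<circ> p) ` (K0 X \<union> F0 X)"

definition k_set :: "'a topology \<Rightarrow> 'a set \<Rightarrow> nat" where
  "k_set X A = card {p A | p. p \<in> K_ops X}"

definition kf_set :: "'a topology \<Rightarrow> 'a set \<Rightarrow> nat" where
  "kf_set X A = card {p A | p. p \<in> KF_ops X}"

text \<open>
  The maxima below are genuine even if the space is infinite, since only finitely many numbers occur
  (see the two finiteness lemmas).
\<close>

definition k_space :: "'a topology \<Rightarrow> nat" where
  "k_space X = Max (k_set X ` Pow (topspace X))"

definition kf_space :: "'a topology \<Rightarrow> nat" where
  "kf_space X = Max (kf_set X ` Pow (topspace X))"

lemma finite_K_ops: "finite (K_ops X)"
  by (simp add: K_ops_def K0_def Let_def)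

lemma finite_KF_ops: "finite (KF_ops X)"
  by (simp add: KF_ops_def K0_def F0_def Let_def)

lemma finite_k_set_values: "finite (k_set X ` Pow (topspace X))"
proof (rule finite_subset)
  show "k_set X ` Pow (topspace X) \<subseteq> {..card (K_ops X)}"
    by (auto simp: k_set_def Setcompr_eq_image intro!: card_image_le finite_K_ops)
qed simp

lemma finite_kf_set_values: "finite (kf_set X ` Pow (topspace X))"
proof (rule finite_subset)
  show "kf_set X ` Pow (topspace X) \<subseteq> {..card (KF_ops X)}"
    by (auto simp: kf_set_def Setcompr_eq_image intro!: card_image_le finite_KF_ops)
qed simp

text \<open>
  The type of a space records which of the operators \<open>ib\<close>, \<open>bi\<close>, \<open>b\<close> coincide with \<open>bib\<close> on it. These
  three have to be treated as symbols rather than as functions: for instance, \<open>{ib}\<close> and \<open>{ib, bi}\<close>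
  would be the same set of functions on a space where \<open>ib = bi\<close>.
\<close>

datatype op_word = IB | BI | B

fun op_of :: "'a topology \<Rightarrow> op_word \<Rightarrow> 'a set_op" where
  "op_of X IB = int_op X \<circ> cl X"
| "op_of X BI = cl X \<circ> int_op X"
| "op_of X B = cl X"

definition same_op :: "'a topology \<Rightarrow> 'a set_op \<Rightarrow> 'a set_op \<Rightarrow> bool" where
  "same_op X p q \<longleftrightarrow> (\<forall>A \<subseteq> topspace X. p A = q A)"

definition type_set :: "'a topology \<Rightarrow> op_word set" where
  "type_set X = {w. same_op X (op_of X w) (cl X \<circ> int_op X \<circ> cl X)}"

definition kuratowski_space :: "'a topology \<Rightarrow> bool" where
  "kuratowski_space X \<longleftrightarrow> type_set X = {}"

definition KD_space :: "'a topology \<Rightarrow> bool" where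
  "KD_space X \<longleftrightarrow> kuratowski_space X \<and>
     (\<forall>A \<subseteq> topspace X. openin X (int_op X (bd X A)) \<and> closedin X (int_op X (bd X A)))"

definition GE_space :: "'a topology \<Rightarrow> bool" where
  "GE_space X \<longleftrightarrow> kuratowski_space X \<and> \<not> KD_space X"

definition ED_space :: "'a topology \<Rightarrow> bool" where
  "ED_space X \<longleftrightarrow> type_set X = {IB}"

definition OU_space :: "'a topology \<Rightarrow> bool" where
  "OU_space X \<longleftrightarrow> type_set X = {BI}"

definition EO_space :: "'a topology \<Rightarrow> bool" where
  "EO_space X \<longleftrightarrow> type_set X = {IB, BI}"

definition partition_space :: "'a topology \<Rightarrow> bool" where
  "partition_space X \<longleftrightarrow> type_set X = {IB, B}"

definition discrete_type_space :: "'a topology \<Rightarrow> bool" where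
  "discrete_type_space X \<longleftrightarrow> type_set X = {IB, BI, B}"

text \<open>
  The first argument only makes explicit the type over which the points of the spaces range.
\<close>

definition k_values :: "'a itself \<Rightarrow> ('a topology \<Rightarrow> bool) \<Rightarrow> nat set" where
  "k_values _ P = {k_space X | X. topspace X \<noteq> {} \<and> P X}"

definition kf_values :: "'a itself \<Rightarrow> ('a topology \<Rightarrow> bool) \<Rightarrow> nat set" where
  "kf_values _ P = {kf_space X | X. topspace X \<noteq> {} \<and> P X}"

end

theory Submission
  imports Defs
begin

text \<open>
Write \<open>b\<close>, \<open>i\<close> and \<open>f\<close> for closure, interior and boundary. A subset \<open>A\<close> determines three disjoint
open sets with dense union: the inner part \<open>ibiA\<close>, where the interior of \<open>A\<close> is dense; the outer part
\<open>X - bibA\<close>, where the interior of the complement is dense; and the mixed part \<open>ifA = ibA - biA\<close>,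
where \<open>A\<close> and its complement are both dense. Every other point is in the closure of at least two of the
parts, and these points are sorted by the parts to which they adhere. Separating from the inner part its
points outside \<open>iA\<close>, and from the outer part its points in \<open>bA\<close>, gives nine regions
(\<open>region_of\<close>). Each operator other than the identity and the complement takes at \<open>A\<close> a value that
is a union of regions, and which regions are united depends on the operator only (\<open>K_values\<close>,
\<open>F_values\<close>). Hence \<open>k(A)\<close> and \<open>k\<^sub>f(A)\<close> are determined by the set of nonempty regions, together
with the information whether \<open>A\<close> itself is one of these unions, which happens if and only if \<open>A\<close> is open or
closed (\<open>set_counts\<close>). A nonempty region forces the open regions to which its points adhere to be nonempty,
and only 85 sets of regions satisfy these conditions; the table \<open>tally_code\<close> lists their counts.

The type of a space says which regions occur in it for some \<open>A\<close> (\<open>type_set_iff\<close>, \<open>KD_space_iff\<close>). So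
nearly all upper bounds and gaps can be read off the table, and the lower bounds follow because a region that
must occur forces many values. Three points need a change of the set \<open>A\<close>.
A set with \<open>k\<^sub>f(A) = 12\<close> is open or closed without being regular, and moving one boundary region into
it or out of it destroys this property but no region; this gives 14 (\<open>kf_set_12_improves\<close>).
If \<open>ifA\<close> is not clopen for some \<open>A\<close>, then the trace of \<open>A\<close> on \<open>ifA\<close> is a set whose mixed part is not
clopen and whose inner part is empty; this bounds the counts of a GE space from below (\<open>MixOut_arises\<close>).
In a KD space a mixed part is clopen and its open subsets have open closures, so no set can have inner
and outer points adhering to one another inside it; hence a set can be replaced there by a set that is dense
and codense, and the points where its inner and outer part adhere to one another remain. This gives 18 as a lower bound and excludes 20
(\<open>KD_splice\<close>, \<open>KD_space_bounds\<close>).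

All values are attained by spaces with at most eight points. A finite space is given by the closures of its
points, and the regions of all its subsets can be computed from this table (\<open>survey_correct\<close>).
\<close>

section \<open>The nine regions of a set\<close>

text \<open>
\<open>Inn\<close>, \<open>Mix\<close> and \<open>Out\<close> are open; \<open>InnThin\<close> and \<open>OutThin\<close> are the nowhere dense rests of the inner
and the outer part. The remaining names tell to which parts a boundary point adheres, \<open>Triple\<close> meaning
all three of them.
\<close>

datatype region = Inn | InnThin | InnMix | InnOut | Mix | MixOut | Triple | OutThin | Out

definition all_regions :: "region list" where
  "all_regions = [Inn, InnThin, InnMix, InnOut, Mix, MixOut, Triple, OutThin, Out]"

text \<open>
The order of the tests replaces explicit differences of the seven sets involved, which are not all comparable:
neither of \<open>bi\<close> and \<open>ib\<close> contains the other in general.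
\<close>

definition region_of :: "'a topology \<Rightarrow> 'a set \<Rightarrow> 'a \<Rightarrow> region" where
  "region_of X A x =
    (let b = X closure_of A; i = X interior_of A; bi = X closure_of i; ib = X interior_of b in
     if x \<in> i then Inn
     else if x \<in> X interior_of bi then InnThin
     else if x \<in> bi then
       (if x \<in> ib then InnMix else if x \<in> X closure_of (ib - bi) then Triple else InnOut)
     else if x \<in> ib then Mix
     else if x \<in> X closure_of ib then MixOut
     else if x \<in> b then OutThin
     else Out)"

definition region_union :: "'a topology \<Rightarrow> 'a set \<Rightarrow> region list \<Rightarrow> 'a set" where
  "region_union X A c = {x \<in> topspace X. region_of X A x \<in> set c}"

text \<open>
The mixed part is the interior of the boundary.
\<close>

lemma interior_of_closure_minus_interior:
  "X interior_of (X closure_of A - X interior_of A)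
     = X interior_of (X closure_of A) - X closure_of (X interior_of A)"
proof -
  have "X closure_of A - X interior_of A = X closure_of A \<inter> (topspace X - X interior_of A)"
    using closure_of_subset_topspace by fastforce
  also have "X interior_of \<dots> = X interior_of (X closure_of A) \<inter> (topspace X - X closure_of (X interior_of A))"
    by (simp add: interior_of_Int interior_of_complement)
  also have "\<dots> = X interior_of (X closure_of A) - X closure_of (X interior_of A)"
    using interior_of_subset_topspace by fastforce
  finally show ?thesis .
qed

text \<open>
Apart from monotonicity, three facts make the nested tests in \<open>region_of\<close> equivalent to membership. The
closure of the open set \<open>u = ib - bi\<close> misses the open set \<open>ibi\<close>. The set \<open>bib\<close> is covered by \<open>bi\<close> and \<open>bu\<close>,
because \<open>ib\<close> is covered by \<open>bi\<close> and \<open>u\<close>. Finally a point of \<open>ib\<close> and \<open>bi\<close> outside \<open>ibi\<close> is in the closure of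
the complement of \<open>bi\<close>, hence, \<open>ib\<close> being open, in \<open>bu\<close>.
\<close>

lemma region_mem:
  fixes X A
  defines "b \<equiv> X closure_of A" and "i \<equiv> X interior_of A"
  defines "bi \<equiv> X closure_of i" and "ib \<equiv> X interior_of b"
  assumes A: "A \<subseteq> topspace X" and x: "x \<in> topspace X"
  shows "x \<in> i \<longleftrightarrow> region_of X A x \<in> set [Inn]"
    and "x \<in> X interior_of bi \<longleftrightarrow> region_of X A x \<in> set [Inn, InnThin]"
    and "x \<in> bi \<longleftrightarrow> region_of X A x \<in> set [Inn, InnThin, InnMix, InnOut, Triple]"
    and "x \<in> ib \<longleftrightarrow> region_of X A x \<in> set [Inn, InnThin, InnMix, Mix]"
    and "x \<in> X closure_of ib \<longleftrightarrow>
      region_of X A x \<in> set [Inn, InnThin, InnMix, InnOut, Mix, MixOut, Triple]"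
    and "x \<in> b \<longleftrightarrow>
      region_of X A x \<in> set [Inn, InnThin, InnMix, InnOut, Mix, MixOut, Triple, OutThin]"
    and "x \<in> X closure_of (ib - bi) \<longleftrightarrow> region_of X A x \<in> set [InnMix, Mix, MixOut, Triple]"
proof -
  have oi: "openin X i" "openin X ib" and cb: "closedin X b" "closedin X bi"
    by (auto simp: i_def ib_def b_def bi_def)
  have sub: "i \<subseteq> bi" "bi \<subseteq> b"
    unfolding i_def bi_def b_def
    by (meson A closure_of_mono closure_of_subset interior_of_subset interior_of_subset_topspace subset_trans)+
  have iibi: "i \<subseteq> X interior_of bi"
    using sub(1) oi(1) interior_of_maximal by blast
  have ibi_bi: "X interior_of bi \<subseteq> bi" by (rule interior_of_subset)
  have ibi_ib: "X interior_of bi \<subseteq> ib" using sub(2) by (simp add: ib_def interior_of_mono)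
  have ib_bib: "ib \<subseteq> X closure_of ib"
    by (simp add: closure_of_subset openin_subset oi)
  have i_ib: "i \<subseteq> ib" using iibi ibi_ib by blast
  have bi_bib: "bi \<subseteq> X closure_of ib" unfolding bi_def by (rule closure_of_mono[OF i_ib])
  have bib_b: "X closure_of ib \<subseteq> b"
    unfolding ib_def by (rule closure_of_minimal[OF interior_of_subset cb(1)])
  have openU: "openin X (ib - bi)" using oi cb by blast
  have U_bU: "ib - bi \<subseteq> X closure_of (ib - bi)"
    by (simp add: closure_of_subset openU openin_subset)
  have bU_bib: "X closure_of (ib - bi) \<subseteq> X closure_of ib" by (rule closure_of_mono) blast
  have bU_ibi: "X closure_of (ib - bi) \<inter> X interior_of bi = {}"
    using openin_Int_closure_of_eq_empty[OF openin_interior_of, of X bi "ib - bi"] ibi_bi by blast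
  \<comment> \<open>Points of \<open>bib\<close> outside \<open>bi\<close> adhere to the mixed part.\<close>
  have mixout: "X closure_of ib \<subseteq> bi \<union> X closure_of (ib - bi)"
  proof -
    have "X closure_of ib \<subseteq> X closure_of (bi \<union> (ib - bi))" by (rule closure_of_mono) blast
    also have "\<dots> = bi \<union> X closure_of (ib - bi)"
      by (simp only: closure_of_Un closure_of_closedin[OF cb(2)])
    finally show ?thesis .
  qed
  \<comment> \<open>Points of \<open>ib\<close> and \<open>bi\<close> outside \<open>ibi\<close> adhere to the mixed part.\<close>
  have innmix: "ib \<inter> bi - X interior_of bi \<subseteq> X closure_of (ib - bi)"
  proof
    fix y assume y: "y \<in> ib \<inter> bi - X interior_of bi"
    have "y \<in> topspace X" using y oi openin_subset by blast
    then have "y \<in> ib \<inter> X closure_of (topspace X - bi)"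
      using y by (auto simp: interior_of_closure_of)
    also have "\<dots> \<subseteq> X closure_of (ib \<inter> (topspace X - bi))"
      by (rule openin_Int_closure_of_subset[OF oi(2)])
    also have "\<dots> \<subseteq> X closure_of (ib - bi)" by (rule closure_of_mono) blast
    finally show "y \<in> X closure_of (ib - bi)" .
  qed
  have R: "region_of X A x =
     (if x \<in> i then Inn
     else if x \<in> X interior_of bi then InnThin
     else if x \<in> bi then
       (if x \<in> ib then InnMix else if x \<in> X closure_of (ib - bi) then Triple else InnOut)
     else if x \<in> ib then Mix
     else if x \<in> X closure_of ib then MixOut
     else if x \<in> b then OutThin
     else Out)"
    by (simp only: region_of_def b_def i_def bi_def ib_def Let_def)
  show "x \<in> i \<longleftrightarrow> region_of X A x \<in> set [Inn]"
    and "x \<in> X interior_of bi \<longleftrightarrow> region_of X A x \<in> set [Inn, InnThin]"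
    and "x \<in> bi \<longleftrightarrow> region_of X A x \<in> set [Inn, InnThin, InnMix, InnOut, Triple]"
    and "x \<in> ib \<longleftrightarrow> region_of X A x \<in> set [Inn, InnThin, InnMix, Mix]"
    and "x \<in> X closure_of ib \<longleftrightarrow>
      region_of X A x \<in> set [Inn, InnThin, InnMix, InnOut, Mix, MixOut, Triple]"
    and "x \<in> b \<longleftrightarrow>
      region_of X A x \<in> set [Inn, InnThin, InnMix, InnOut, Mix, MixOut, Triple, OutThin]"
    and "x \<in> X closure_of (ib - bi) \<longleftrightarrow> region_of X A x \<in> set [InnMix, Mix, MixOut, Triple]"
    using iibi ibi_bi ibi_ib ib_bib bi_bib bib_b U_bU bU_bib bU_ibi mixout innmix sub
    by (auto simp: R)
qed

lemma region_union_eqI: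
  assumes "S \<subseteq> topspace X" "\<And>x. x \<in> topspace X \<Longrightarrow> x \<in> S \<longleftrightarrow> region_of X A x \<in> set c"
  shows "region_union X A c = S"
  using assms by (auto simp: region_union_def)

lemma K_region_unions:
  assumes A: "A \<subseteq> topspace X"
  shows "X interior_of A = region_union X A [Inn]"
    and "X interior_of (X closure_of (X interior_of A)) = region_union X A [Inn, InnThin]"
    and "X closure_of (X interior_of A) = region_union X A [Inn, InnThin, InnMix, InnOut, Triple]"
    and "X interior_of (X closure_of A) = region_union X A [Inn, InnThin, InnMix, Mix]"
    and "X closure_of (X interior_of (X closure_of A)) =
      region_union X A [Inn, InnThin, InnMix, InnOut, Mix, MixOut, Triple]"
    and "X closure_of A = region_union X A [Inn, InnThin, InnMix, InnOut, Mix, MixOut, Triple, OutThin]"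
  using region_mem[OF A] interior_of_subset_topspace[of X] closure_of_subset_topspace[of X]
  by (intro region_union_eqI[symmetric]; blast)+

section \<open>Operator values as unions of regions\<close>

text \<open>
The codes of \<open>b, i, bi, ib, bib, ibi\<close>.
\<close>

definition K_codes :: "region list list" where
  "K_codes =
    [[Inn, InnThin, InnMix, InnOut, Mix, MixOut, Triple, OutThin],
     [Inn],
     [Inn, InnThin, InnMix, InnOut, Triple],
     [Inn, InnThin, InnMix, Mix],
     [Inn, InnThin, InnMix, InnOut, Mix, MixOut, Triple],
     [Inn, InnThin]]"

text \<open>
The codes of \<open>0, f, if, fif, bif, ff, fb, fi, fbi, fib\<close>.
\<close>

definition F_codes :: "region list list" where
  "F_codes =
    [[],
     [InnThin, InnMix, InnOut, Mix, MixOut, Triple, OutThin],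
     [Mix],
     [InnMix, MixOut, Triple],
     [InnMix, Mix, MixOut, Triple],
     [InnThin, InnMix, InnOut, MixOut, Triple, OutThin],
     [InnOut, MixOut, Triple, OutThin],
     [InnThin, InnMix, InnOut, Triple],
     [InnMix, InnOut, Triple],
     [InnOut, MixOut, Triple]]"

lemma cl_eq: "cl X S = X closure_of S" by (simp add: cl_def)

lemma bd_eq: "S \<subseteq> topspace X \<Longrightarrow> bd X S = X closure_of S - X interior_of S"
  by (simp add: bd_eq_frontier_of frontier_of_def)

lemma bd_openin: "openin X S \<Longrightarrow> bd X S = X closure_of S - S"
  by (simp add: bd_eq openin_subset interior_of_openin)

lemma bd_closedin: "closedin X S \<Longrightarrow> bd X S = S - X interior_of S"
  by (simp add: bd_eq closedin_subset closure_of_closedin)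

lemma int_op_closure: "int_op X (X closure_of S) = X interior_of (X closure_of S)"
  by (simp add: int_op_eq_interior_of closure_of_subset_topspace)

lemma int_bd: "A \<subseteq> topspace X \<Longrightarrow>
   int_op X (bd X A) = X interior_of (X closure_of A) - X closure_of (X interior_of A)"
  using closure_of_subset_topspace[of X A]
  by (subst int_op_eq_interior_of)
     (auto simp: bd_eq interior_of_closure_minus_interior)

lemma K_values:
  assumes "A \<subseteq> topspace X"
  shows "(\<lambda>p. p A) ` K0 X = insert A (region_union X A ` set K_codes)"
proof -
  let ?b = "X closure_of A" and ?i = "X interior_of A"
  have "(\<lambda>p. p A) ` K0 X = {A, ?b, ?i, X closure_of ?i, X interior_of ?b,
      X closure_of (X interior_of ?b), X interior_of (X closure_of ?i)}"
    using assms by (simp add: K0_def Let_def cl_eq int_op_eq_interior_of closure_of_subset_topspace)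
  then show ?thesis
    unfolding K_codes_def by (simp only: list.set image_insert image_empty K_region_unions[OF assms, symmetric])
qed

text \<open>
The boundary of an open set is its closure without the set, and the boundary of a closed set is the set
without its interior. So every value of an operator in \<open>F0\<close> is a difference of sets of the form treated in
\<open>region_mem\<close>.
\<close>

lemma F_values:
  assumes "A \<subseteq> topspace X"
  shows "(\<lambda>p. p A) ` F0 X = region_union X A ` set F_codes"
proof -
  let ?b = "X closure_of A" and ?i = "X interior_of A"
  let ?bi = "X closure_of ?i" and ?ib = "X interior_of ?b"
  let ?u = "?ib - ?bi"
  have ou: "openin X ?u" by (simp add: openin_diff)
  have cf: "closedin X (bd X A)" using assms by (simp add: bd_eq_frontier_of closedin_frontier_of)
  have iu: "X interior_of (?b - ?i) = ?u" by (rule interior_of_closure_minus_interior)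
  have "(\<lambda>p. p A) ` F0 X = {{}, ?b - ?i, ?u, X closure_of ?u - ?u, X closure_of ?u,
     (?b - ?i) - ?u, ?b - ?ib, ?bi - ?i, ?bi - X interior_of ?bi, X closure_of ?ib - ?ib}"
    using assms iu
    by (simp add: F0_def Let_def zero_op_def cl_eq int_bd bd_openin[OF ou] bd_closedin[OF cf]
         bd_openin bd_closedin int_op_eq_interior_of int_op_closure)
       (simp add: bd_eq)
  moreover have "S = region_union X A c"
    if "\<And>x. x \<in> topspace X \<Longrightarrow> x \<in> S \<longleftrightarrow> region_of X A x \<in> set c" "S \<subseteq> topspace X" for S c
    using that by (auto simp: region_union_def)
  note B = this
  note M = region_mem[OF assms]
  have ss: "?b \<subseteq> topspace X" "?bi \<subseteq> topspace X" "X closure_of ?ib \<subseteq> topspace X" "X closure_of ?u \<subseteq> topspace X"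
    by (rule closure_of_subset_topspace)+
  have bl: "{} = region_union X A (F_codes ! 0)" "?b - ?i = region_union X A (F_codes ! 1)" "?u = region_union X A (F_codes ! 2)"
    "X closure_of ?u - ?u = region_union X A (F_codes ! 3)" "X closure_of ?u = region_union X A (F_codes ! 4)"
    "(?b - ?i) - ?u = region_union X A (F_codes ! 5)" "?b - ?ib = region_union X A (F_codes ! 6)"
    "?bi - ?i = region_union X A (F_codes ! 7)" "?bi - X interior_of ?bi = region_union X A (F_codes ! 8)"
    "X closure_of ?ib - ?ib = region_union X A (F_codes ! 9)"
    by (rule B; use ss interior_of_subset_topspace[of X] in \<open>force simp: M F_codes_def\<close>)+
  ultimately show ?thesis by (simp add: F_codes_def)
qed

section \<open>Counting the operator values of a set\<close>

definition regions :: "'a topology \<Rightarrow> 'a set \<Rightarrow> region set" where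
  "regions X A = region_of X A ` topspace X"

text \<open>
Each region forces the open regions to which its points adhere to be nonempty.
\<close>

definition admissible :: "region set \<Rightarrow> bool" where
  "admissible N \<longleftrightarrow> N \<noteq> {} \<and>
     (InnThin \<in> N \<longrightarrow> Inn \<in> N) \<and> (OutThin \<in> N \<longrightarrow> Out \<in> N) \<and>
     (InnMix \<in> N \<longrightarrow> Inn \<in> N \<and> Mix \<in> N) \<and> (InnOut \<in> N \<longrightarrow> Inn \<in> N \<and> Out \<in> N) \<and>
     (MixOut \<in> N \<longrightarrow> Mix \<in> N \<and> Out \<in> N) \<and>
     (Triple \<in> N \<longrightarrow> Inn \<in> N \<and> Mix \<in> N \<and> Out \<in> N)"

lemma region_union_empty_iff: "region_union X A c = {} \<longleftrightarrow> set c \<inter> regions X A = {}"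
  by (auto simp: region_union_def regions_def)

lemma region_union_eq_iff: "region_union X A c = region_union X A d \<longleftrightarrow> set c \<inter> regions X A = set d \<inter> regions X A"
  by (auto simp: region_union_def regions_def)

lemma UNIV_region: "UNIV = set all_regions"
proof -
  have "x \<in> set all_regions" for x by (cases x) (simp_all add: all_regions_def)
  then show ?thesis by auto
qed

lemma region_union_Inn: "A \<subseteq> topspace X \<Longrightarrow> region_union X A [Inn] = X interior_of A"
  by (rule K_region_unions(1)[symmetric])

lemma region_union_Mix:
  assumes "A \<subseteq> topspace X"
  shows "region_union X A [Mix] = X interior_of (X closure_of A) - X closure_of (X interior_of A)"
  using region_mem(3,4)[OF assms] interior_of_subset_topspace[of X "X closure_of A"]
  by (intro region_union_eqI) auto

lemma region_union_Out:
  assumes "A \<subseteq> topspace X"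
  shows "region_union X A [Out] = topspace X - X closure_of A"
proof (rule region_union_eqI)
  fix x assume "x \<in> topspace X"
  then show "x \<in> topspace X - X closure_of A \<longleftrightarrow> region_of X A x \<in> set [Out]"
    using region_mem(6)[OF assms] by (cases "region_of X A x") auto
qed blast

lemma admissible_regions:
  assumes A: "A \<subseteq> topspace X" and ne: "topspace X \<noteq> {}"
  shows "admissible (regions X A)"
proof -
  let ?b = "X closure_of A" and ?i = "X interior_of A"
  let ?bi = "X closure_of ?i" and ?ib = "X interior_of ?b"
  let ?u = "?ib - ?bi"
  note M = region_mem[OF A]
  have no_inn: "?bi = {}" if "Inn \<notin> regions X A"
  proof -
    have "?i = {}" using that region_union_Inn[OF A] region_union_empty_iff[of X A "[Inn]"] by simp
    then show ?thesis by simp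
  qed
  have no_mix: "X closure_of ?u = {}" if "Mix \<notin> regions X A"
  proof -
    have "?u = {}" using that region_union_Mix[OF A] region_union_empty_iff[of X A "[Mix]"] by simp
    then show ?thesis by (simp only: closure_of_empty)
  qed
  have no_out: "X interior_of ?b = topspace X" if "Out \<notin> regions X A"
  proof -
    have "topspace X - ?b = {}" using that region_union_Out[OF A] region_union_empty_iff[of X A "[Out]"] by simp
    then have "?b = topspace X" using closure_of_subset_topspace[of X A] by blast
    then show ?thesis by simp
  qed
  have inn: "Inn \<in> regions X A"
    if "x \<in> topspace X" "region_of X A x \<in> {InnThin, InnMix, InnOut, Triple}" for x
    using no_inn M(3)[OF that(1)] that(2) by auto
  have mix: "Mix \<in> regions X A"
    if "x \<in> topspace X" "region_of X A x \<in> {InnMix, MixOut, Triple}" for x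
    using no_mix M(7)[OF that(1)] that(2) by auto
  have out: "Out \<in> regions X A"
    if "x \<in> topspace X" "region_of X A x \<in> {OutThin, InnOut, MixOut, Triple}" for x
    using no_out M(4)[OF that(1)] that by auto
  show ?thesis
    unfolding admissible_def using inn mix out ne by (force simp: regions_def)
qed

definition complement_code :: "region list \<Rightarrow> region list" where
  "complement_code c = filter (\<lambda>r. r \<notin> set c) all_regions"

lemma region_union_complement_code: "region_union X A (complement_code c) = topspace X - region_union X A c"
  using UNIV_region by (auto simp: region_union_def complement_code_def)

definition with_complements :: "region list list \<Rightarrow> region list list" where
  "with_complements cs = cs @ map complement_code cs"

text \<open>
Two unions of regions coincide if and only if their codes have the same trace on the list \<open>ns\<close> of nonempty
regions.
\<close>

definition traces :: "region list list \<Rightarrow> region list \<Rightarrow> nat" where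
  "traces cs ns = length (remdups (map (\<lambda>c. filter (\<lambda>r. r \<in> set c) ns) (with_complements cs)))"

lemma card_image_same_kernel:
  assumes "finite S" "\<And>c d. f c = f d \<longleftrightarrow> g c = g d"
  shows "card (f ` S) = card (g ` S)"
  using assms(1) by (induction rule: finite_induct) (simp_all add: card_insert_if image_iff assms(2))

lemma filter_eq_iff_Int:
  "filter (\<lambda>r. r \<in> C) ns = filter (\<lambda>r. r \<in> D) ns \<longleftrightarrow> C \<inter> set ns = D \<inter> set ns"
proof
  assume "filter (\<lambda>r. r \<in> C) ns = filter (\<lambda>r. r \<in> D) ns"
  from arg_cong[OF this, of set] show "C \<inter> set ns = D \<inter> set ns" by auto
qed (auto intro: filter_cong)

lemma card_region_unions:
  assumes "regions X A = set ns"
  shows "card (region_union X A ` set (with_complements cs)) = traces cs ns"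
proof -
  have "card (region_union X A ` set (with_complements cs)) =
     card ((\<lambda>c. filter (\<lambda>r. r \<in> set c) ns) ` set (with_complements cs))"
    by (rule card_image_same_kernel) (simp_all add: region_union_eq_iff assms filter_eq_iff_Int)
  also have "\<dots> = traces cs ns" by (simp only: traces_def set_map length_remdups_card_conv)
  finally show ?thesis .
qed

definition patterns :: "region list list" where
  "patterns = filter (\<lambda>ns. admissible (set ns)) (subseqs all_regions)"

definition pattern :: "'a topology \<Rightarrow> 'a set \<Rightarrow> region list" where
  "pattern X A = filter (\<lambda>r. r \<in> regions X A) all_regions"

lemma set_pattern: "set (pattern X A) = regions X A"
  using UNIV_region by (auto simp: pattern_def)

lemma pattern_in_patterns:
  assumes "A \<subseteq> topspace X" "topspace X \<noteq> {}"
  shows "pattern X A \<in> set patterns"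
proof -
  have "filter P xs \<in> set (subseqs xs)" for P and xs :: "region list"
    by (induction xs) (auto simp: Let_def)
  then show ?thesis using admissible_regions[OF assms]
    by (simp add: patterns_def set_pattern) (simp add: pattern_def)
qed

definition open_or_closed :: "'a topology \<Rightarrow> 'a set \<Rightarrow> bool" where
  "open_or_closed X A \<longleftrightarrow> openin X A \<or> closedin X A"

lemma K_union_open_or_closed:
  assumes A: "A \<subseteq> topspace X" and c: "c \<in> set K_codes"
  shows "open_or_closed X (region_union X A c)"
proof -
  have "\<forall>c \<in> set K_codes. open_or_closed X (region_union X A c)" by (simp add: K_codes_def open_or_closed_def K_region_unions[OF A, symmetric])
  then show ?thesis using c by blast
qed

lemma op_values_with_complements:
  assumes "(\<lambda>p. p A) ` S = insert A (region_union X A ` set cs)"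
  shows "{p A | p. p \<in> S \<union> (\<lambda>p. cmp X \<circ> p) ` S} =
     {A, topspace X - A} \<union> region_union X A ` set (with_complements cs)"
proof -
  have ins: "insert a P \<union> insert b Q = {a, b} \<union> (P \<union> Q)" for a b :: "'a set" and P Q by blast
  have "{p A | p. p \<in> S \<union> (\<lambda>p. cmp X \<circ> p) ` S} =
      (\<lambda>p. p A) ` S \<union> (\<lambda>T. topspace X - T) ` (\<lambda>p. p A) ` S"
    by (simp only: Setcompr_eq_image image_Un image_image comp_def cmp_def)
  also have "\<dots> = {A, topspace X - A} \<union> (region_union X A ` set cs \<union> (\<lambda>c. topspace X - region_union X A c) ` set cs)"
    by (simp only: assms image_insert image_image ins)
  also have "\<dots> = {A, topspace X - A} \<union> region_union X A ` set (with_complements cs)"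
    by (simp only: with_complements_def set_append set_map image_Un image_image region_union_complement_code)
  finally show ?thesis .
qed

lemma K_ops_values:
  assumes A: "A \<subseteq> topspace X"
  shows "{p A | p. p \<in> K_ops X} = {A, topspace X - A} \<union> region_union X A ` set (with_complements K_codes)"
  unfolding K_ops_def by (rule op_values_with_complements[OF K_values[OF A]])

lemma KF_ops_values:
  assumes A: "A \<subseteq> topspace X"
  shows "{p A | p. p \<in> KF_ops X} =
      {A, topspace X - A} \<union> region_union X A ` set (with_complements (K_codes @ F_codes))"
proof -
  have "(\<lambda>p. p A) ` (K0 X \<union> F0 X) = insert A (region_union X A ` set (K_codes @ F_codes))"
    by (simp only: image_Un K_values[OF A] F_values[OF A] set_append Un_insert_left)
  then show ?thesis unfolding KF_ops_def by (rule op_values_with_complements)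
qed

text \<open>
The 85 admissible sets of regions, as sublists of \<open>all_regions\<close>. The explicit list is a code equation, and so
is the table of counts below, so that the later computations look up their results.
\<close>

lemma patterns_code [code]: "patterns =
  [[Inn, InnThin, InnMix, InnOut, Mix, MixOut, Triple, OutThin, Out],
   [Inn, InnThin, InnMix, InnOut, Mix, MixOut, Triple, Out],
   [Inn, InnThin, InnMix, InnOut, Mix, MixOut, OutThin, Out],
   [Inn, InnThin, InnMix, InnOut, Mix, MixOut, Out],
   [Inn, InnThin, InnMix, InnOut, Mix, Triple, OutThin, Out],
   [Inn, InnThin, InnMix, InnOut, Mix, Triple, Out],
   [Inn, InnThin, InnMix, InnOut, Mix, OutThin, Out],
   [Inn, InnThin, InnMix, InnOut, Mix, Out],
   [Inn, InnThin, InnMix, Mix, MixOut, Triple, OutThin, Out],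
   [Inn, InnThin, InnMix, Mix, MixOut, Triple, Out],
   [Inn, InnThin, InnMix, Mix, MixOut, OutThin, Out],
   [Inn, InnThin, InnMix, Mix, MixOut, Out],
   [Inn, InnThin, InnMix, Mix, Triple, OutThin, Out],
   [Inn, InnThin, InnMix, Mix, Triple, Out],
   [Inn, InnThin, InnMix, Mix, OutThin, Out],
   [Inn, InnThin, InnMix, Mix, Out],
   [Inn, InnThin, InnMix, Mix],
   [Inn, InnThin, InnOut, Mix, MixOut, Triple, OutThin, Out],
   [Inn, InnThin, InnOut, Mix, MixOut, Triple, Out],
   [Inn, InnThin, InnOut, Mix, MixOut, OutThin, Out],
   [Inn, InnThin, InnOut, Mix, MixOut, Out],
   [Inn, InnThin, InnOut, Mix, Triple, OutThin, Out],
   [Inn, InnThin, InnOut, Mix, Triple, Out],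
   [Inn, InnThin, InnOut, Mix, OutThin, Out],
   [Inn, InnThin, InnOut, Mix, Out],
   [Inn, InnThin, InnOut, OutThin, Out],
   [Inn, InnThin, InnOut, Out],
   [Inn, InnThin, Mix, MixOut, Triple, OutThin, Out],
   [Inn, InnThin, Mix, MixOut, Triple, Out],
   [Inn, InnThin, Mix, MixOut, OutThin, Out],
   [Inn, InnThin, Mix, MixOut, Out],
   [Inn, InnThin, Mix, Triple, OutThin, Out],
   [Inn, InnThin, Mix, Triple, Out],
   [Inn, InnThin, Mix, OutThin, Out],
   [Inn, InnThin, Mix, Out],
   [Inn, InnThin, Mix],
   [Inn, InnThin, OutThin, Out],
   [Inn, InnThin, Out],
   [Inn, InnThin],
   [Inn, InnMix, InnOut, Mix, MixOut, Triple, OutThin, Out],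
   [Inn, InnMix, InnOut, Mix, MixOut, Triple, Out],
   [Inn, InnMix, InnOut, Mix, MixOut, OutThin, Out],
   [Inn, InnMix, InnOut, Mix, MixOut, Out],
   [Inn, InnMix, InnOut, Mix, Triple, OutThin, Out],
   [Inn, InnMix, InnOut, Mix, Triple, Out],
   [Inn, InnMix, InnOut, Mix, OutThin, Out],
   [Inn, InnMix, InnOut, Mix, Out],
   [Inn, InnMix, Mix, MixOut, Triple, OutThin, Out],
   [Inn, InnMix, Mix, MixOut, Triple, Out],
   [Inn, InnMix, Mix, MixOut, OutThin, Out],
   [Inn, InnMix, Mix, MixOut, Out],
   [Inn, InnMix, Mix, Triple, OutThin, Out],
   [Inn, InnMix, Mix, Triple, Out],
   [Inn, InnMix, Mix, OutThin, Out],
   [Inn, InnMix, Mix, Out],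
   [Inn, InnMix, Mix],
   [Inn, InnOut, Mix, MixOut, Triple, OutThin, Out],
   [Inn, InnOut, Mix, MixOut, Triple, Out],
   [Inn, InnOut, Mix, MixOut, OutThin, Out],
   [Inn, InnOut, Mix, MixOut, Out],
   [Inn, InnOut, Mix, Triple, OutThin, Out],
   [Inn, InnOut, Mix, Triple, Out],
   [Inn, InnOut, Mix, OutThin, Out],
   [Inn, InnOut, Mix, Out],
   [Inn, InnOut, OutThin, Out],
   [Inn, InnOut, Out],
   [Inn, Mix, MixOut, Triple, OutThin, Out],
   [Inn, Mix, MixOut, Triple, Out],
   [Inn, Mix, MixOut, OutThin, Out],
   [Inn, Mix, MixOut, Out],
   [Inn, Mix, Triple, OutThin, Out],
   [Inn, Mix, Triple, Out],
   [Inn, Mix, OutThin, Out],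
   [Inn, Mix, Out],
   [Inn, Mix],
   [Inn, OutThin, Out],
   [Inn, Out],
   [Inn],
   [Mix, MixOut, OutThin, Out],
   [Mix, MixOut, Out],
   [Mix, OutThin, Out],
   [Mix, Out],
   [Mix],
   [OutThin, Out],
   [Out]]"
  by code_simp

text \<open>
The numbers of distinct unions of regions among the values of the operators in \<open>K\<close> and in \<open>KF\<close>. The
values \<open>A\<close> and its complement are counted separately.
\<close>

definition tally :: "region list \<Rightarrow> nat \<times> nat" where
  "tally ns = (traces K_codes ns, traces (K_codes @ F_codes) ns)"

lemma tally_code [code]:
"tally [Inn, InnThin, InnMix, InnOut, Mix, MixOut, Triple, OutThin, Out] = (12, 32)"
  "tally [Inn, InnThin, InnMix, InnOut, Mix, MixOut, Triple, Out] = (10, 28)"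
  "tally [Inn, InnThin, InnMix, InnOut, Mix, MixOut, OutThin, Out] = (12, 32)"
  "tally [Inn, InnThin, InnMix, InnOut, Mix, MixOut, Out] = (10, 28)"
  "tally [Inn, InnThin, InnMix, InnOut, Mix, Triple, OutThin, Out] = (12, 32)"
  "tally [Inn, InnThin, InnMix, InnOut, Mix, Triple, Out] = (10, 26)"
  "tally [Inn, InnThin, InnMix, InnOut, Mix, OutThin, Out] = (12, 32)"
  "tally [Inn, InnThin, InnMix, InnOut, Mix, Out] = (10, 26)"
  "tally [Inn, InnThin, InnMix, Mix, MixOut, Triple, OutThin, Out] = (12, 32)"
  "tally [Inn, InnThin, InnMix, Mix, MixOut, Triple, Out] = (10, 28)"
  "tally [Inn, InnThin, InnMix, Mix, MixOut, OutThin, Out] = (12, 32)"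
  "tally [Inn, InnThin, InnMix, Mix, MixOut, Out] = (10, 28)"
  "tally [Inn, InnThin, InnMix, Mix, Triple, OutThin, Out] = (12, 30)"
  "tally [Inn, InnThin, InnMix, Mix, Triple, Out] = (10, 24)"
  "tally [Inn, InnThin, InnMix, Mix, OutThin, Out] = (10, 26)"
  "tally [Inn, InnThin, InnMix, Mix, Out] = (8, 20)"
  "tally [Inn, InnThin, InnMix, Mix] = (8, 12)"
  "tally [Inn, InnThin, InnOut, Mix, MixOut, Triple, OutThin, Out] = (12, 32)"
  "tally [Inn, InnThin, InnOut, Mix, MixOut, Triple, Out] = (10, 28)"
  "tally [Inn, InnThin, InnOut, Mix, MixOut, OutThin, Out] = (12, 32)"
  "tally [Inn, InnThin, InnOut, Mix, MixOut, Out] = (10, 28)"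
  "tally [Inn, InnThin, InnOut, Mix, Triple, OutThin, Out] = (12, 30)"
  "tally [Inn, InnThin, InnOut, Mix, Triple, Out] = (10, 24)"
  "tally [Inn, InnThin, InnOut, Mix, OutThin, Out] = (12, 26)"
  "tally [Inn, InnThin, InnOut, Mix, Out] = (10, 20)"
  "tally [Inn, InnThin, InnOut, OutThin, Out] = (8, 18)"
  "tally [Inn, InnThin, InnOut, Out] = (6, 12)"
  "tally [Inn, InnThin, Mix, MixOut, Triple, OutThin, Out] = (12, 30)"
  "tally [Inn, InnThin, Mix, MixOut, Triple, Out] = (10, 26)"
  "tally [Inn, InnThin, Mix, MixOut, OutThin, Out] = (10, 26)"
  "tally [Inn, InnThin, Mix, MixOut, Out] = (8, 22)"
  "tally [Inn, InnThin, Mix, Triple, OutThin, Out] = (12, 28)"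
  "tally [Inn, InnThin, Mix, Triple, Out] = (10, 22)"
  "tally [Inn, InnThin, Mix, OutThin, Out] = (8, 20)"
  "tally [Inn, InnThin, Mix, Out] = (6, 14)"
  "tally [Inn, InnThin, Mix] = (6, 8)"
  "tally [Inn, InnThin, OutThin, Out] = (6, 14)"
  "tally [Inn, InnThin, Out] = (4, 8)"
  "tally [Inn, InnThin] = (4, 4)"
  "tally [Inn, InnMix, InnOut, Mix, MixOut, Triple, OutThin, Out] = (10, 28)"
  "tally [Inn, InnMix, InnOut, Mix, MixOut, Triple, Out] = (8, 24)"
  "tally [Inn, InnMix, InnOut, Mix, MixOut, OutThin, Out] = (10, 28)"
  "tally [Inn, InnMix, InnOut, Mix, MixOut, Out] = (8, 24)"
  "tally [Inn, InnMix, InnOut, Mix, Triple, OutThin, Out] = (10, 28)"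
  "tally [Inn, InnMix, InnOut, Mix, Triple, Out] = (8, 22)"
  "tally [Inn, InnMix, InnOut, Mix, OutThin, Out] = (10, 28)"
  "tally [Inn, InnMix, InnOut, Mix, Out] = (8, 22)"
  "tally [Inn, InnMix, Mix, MixOut, Triple, OutThin, Out] = (10, 28)"
  "tally [Inn, InnMix, Mix, MixOut, Triple, Out] = (8, 20)"
  "tally [Inn, InnMix, Mix, MixOut, OutThin, Out] = (10, 28)"
  "tally [Inn, InnMix, Mix, MixOut, Out] = (8, 20)"
  "tally [Inn, InnMix, Mix, Triple, OutThin, Out] = (10, 26)"
  "tally [Inn, InnMix, Mix, Triple, Out] = (8, 18)"
  "tally [Inn, InnMix, Mix, OutThin, Out] = (8, 22)"
  "tally [Inn, InnMix, Mix, Out] = (6, 14)"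
  "tally [Inn, InnMix, Mix] = (6, 8)"
  "tally [Inn, InnOut, Mix, MixOut, Triple, OutThin, Out] = (10, 26)"
  "tally [Inn, InnOut, Mix, MixOut, Triple, Out] = (8, 22)"
  "tally [Inn, InnOut, Mix, MixOut, OutThin, Out] = (10, 26)"
  "tally [Inn, InnOut, Mix, MixOut, Out] = (8, 22)"
  "tally [Inn, InnOut, Mix, Triple, OutThin, Out] = (10, 24)"
  "tally [Inn, InnOut, Mix, Triple, Out] = (8, 20)"
  "tally [Inn, InnOut, Mix, OutThin, Out] = (10, 20)"
  "tally [Inn, InnOut, Mix, Out] = (8, 16)"
  "tally [Inn, InnOut, OutThin, Out] = (6, 12)"
  "tally [Inn, InnOut, Out] = (4, 8)"
  "tally [Inn, Mix, MixOut, Triple, OutThin, Out] = (10, 24)"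
  "tally [Inn, Mix, MixOut, Triple, Out] = (8, 18)"
  "tally [Inn, Mix, MixOut, OutThin, Out] = (8, 20)"
  "tally [Inn, Mix, MixOut, Out] = (6, 14)"
  "tally [Inn, Mix, Triple, OutThin, Out] = (10, 22)"
  "tally [Inn, Mix, Triple, Out] = (8, 16)"
  "tally [Inn, Mix, OutThin, Out] = (6, 14)"
  "tally [Inn, Mix, Out] = (4, 8)"
  "tally [Inn, Mix] = (4, 4)"
  "tally [Inn, OutThin, Out] = (4, 8)"
  "tally [Inn, Out] = (2, 4)"
  "tally [Inn] = (2, 2)"
  "tally [Mix, MixOut, OutThin, Out] = (8, 12)"
  "tally [Mix, MixOut, Out] = (6, 8)"
  "tally [Mix, OutThin, Out] = (6, 8)"
  "tally [Mix, Out] = (4, 4)"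
  "tally [Mix] = (2, 2)"
  "tally [OutThin, Out] = (4, 4)"
  "tally [Out] = (2, 2)"
  by code_simp+

text \<open>
If a set containing \<open>iA\<close> and contained in \<open>bA\<close> is a union of regions given by one of the 32 codes, and the
mixed part is empty, then it is already the value of an operator in \<open>K0\<close>.
\<close>

lemma trace_open_or_closed:
  "\<forall>ns \<in> set patterns. \<forall>c \<in> set (with_complements (K_codes @ F_codes)).
     if Mix \<in> set ns \<or> Inn \<in> set ns \<and> Inn \<notin> set c \<or> Out \<in> set ns \<and> Out \<in> set c then True else
     (\<exists>d \<in> set K_codes. filter (\<lambda>r. r \<in> set c) ns = filter (\<lambda>r. r \<in> set d) ns)"
  by code_simp

lemma closure_Mix:
  assumes A: "A \<subseteq> topspace X"
  shows "X closure_of region_union X A [Mix] = region_union X A [InnMix, Mix, MixOut, Triple]"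
  unfolding region_union_Mix[OF A]
  using region_mem[OF A] closure_of_subset_topspace[of X] by (intro region_union_eqI[symmetric]; blast)

text \<open>
If \<open>A\<close> is open then \<open>A = iA\<close>, so that \<open>bA = biA\<close>; if \<open>A\<close> is closed then \<open>A = bA\<close>, so that \<open>ibA = iA\<close>.
Conversely, if only \<open>Inn\<close> and \<open>Out\<close> occur, then \<open>bA = iA\<close>.
\<close>

lemma regions_open_or_closed:
  assumes A: "A \<subseteq> topspace X"
  shows "openin X A \<Longrightarrow> OutThin \<notin> regions X A"
    and "closedin X A \<Longrightarrow> InnThin \<notin> regions X A"
    and "open_or_closed X A \<Longrightarrow> Mix \<notin> regions X A"
    and "regions X A \<subseteq> {Inn, Out} \<Longrightarrow> open_or_closed X A"
proof -
  note B = K_region_unions[OF A]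
  have o: "OutThin \<notin> regions X A \<and> Mix \<notin> regions X A" if "openin X A"
  proof -
    have "X interior_of A = A" using that by (simp add: interior_of_openin)
    then have "X closure_of A = X closure_of (X interior_of A)" by simp
    then show ?thesis unfolding B(3,6) by (auto simp: region_union_eq_iff)
  qed
  have c: "InnThin \<notin> regions X A \<and> Mix \<notin> regions X A" if "closedin X A"
  proof -
    have "X closure_of A = A" using that by (simp add: closure_of_closedin)
    then have "X interior_of (X closure_of A) = X interior_of A" by simp
    then show ?thesis unfolding B(1,4) by (auto simp: region_union_eq_iff)
  qed
  show "openin X A \<Longrightarrow> OutThin \<notin> regions X A" "closedin X A \<Longrightarrow> InnThin \<notin> regions X A"
    "open_or_closed X A \<Longrightarrow> Mix \<notin> regions X A"
    using o c by (auto simp: open_or_closed_def)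
  assume "regions X A \<subseteq> {Inn, Out}"
  then have "X closure_of A = X interior_of A" unfolding B by (auto simp: region_union_eq_iff)
  then have "A = X interior_of A" using A closure_of_subset interior_of_subset by fastforce
  then show "open_or_closed X A" by (metis open_or_closed_def openin_interior_of)
qed

text \<open>
Both \<open>A\<close> and its complement are dense in the mixed part, which therefore cannot be contained in \<open>A\<close> or be
disjoint from it; so it is empty if \<open>A\<close> is a union of regions. Since \<open>A\<close> is between \<open>iA\<close> and \<open>bA\<close>, it is
then the value at \<open>A\<close> of one of \<open>b, i, bi, ib, bib, ibi\<close>, and all these values are open or closed.
\<close>

lemma union_open_or_closed:
  assumes A: "A \<subseteq> topspace X" and ne: "topspace X \<noteq> {}"
    and c: "c \<in> set (with_complements (K_codes @ F_codes))" and Ac: "A = region_union X A c"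
  shows "open_or_closed X A"
proof -
  have inn: "Inn \<in> set c" if "Inn \<in> regions X A"
  proof -
    have "region_union X A [Inn] \<subseteq> region_union X A c" using Ac region_union_Inn[OF A] interior_of_subset[of X A] by simp
    then show ?thesis using that by (force simp: region_union_def regions_def)
  qed
  have out: "Out \<notin> set c" if "Out \<in> regions X A"
  proof -
    have "region_union X A [Out] \<inter> region_union X A c = {}"
      using Ac region_union_Out[OF A] closure_of_subset[OF A] by auto
    then show ?thesis using that by (force simp: region_union_def regions_def)
  qed
  have mix: "Mix \<notin> regions X A"
  proof
    assume M: "Mix \<in> regions X A"
    let ?U = "region_union X A [Mix]"
    have U: "openin X ?U" unfolding region_union_Mix[OF A] by (simp add: openin_diff)
    have ne: "?U \<noteq> {}" using M by (simp add: region_union_empty_iff)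
    have "?U \<subseteq> A \<or> ?U \<inter> A = {}"
      by (subst (2 4) Ac) (auto simp: region_union_def)
    then show False
    proof
      assume "?U \<subseteq> A"
      then have "?U \<subseteq> X interior_of A" by (simp add: U interior_of_maximal)
      then have "?U \<subseteq> region_union X A [Inn]" by (simp add: region_union_Inn[OF A])
      then show False using ne by (auto simp: region_union_def)
    next
      assume "?U \<inter> A = {}"
      then have "?U \<inter> X closure_of A = {}" by (simp add: U openin_Int_closure_of_eq_empty)
      then show False using ne unfolding K_region_unions(6)[OF A] by (auto simp: region_union_def)
    qed
  qed
  have "\<exists>d \<in> set K_codes. filter (\<lambda>r. r \<in> set c) (pattern X A) = filter (\<lambda>r. r \<in> set d) (pattern X A)"
    using trace_open_or_closed[rule_format, OF pattern_in_patterns[OF A ne] c] inn out mix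
    by (auto simp: set_pattern)
  then obtain d where d: "d \<in> set K_codes" "region_union X A c = region_union X A d"
    by (auto simp: filter_eq_iff_Int region_union_eq_iff set_pattern)
  then show ?thesis using K_union_open_or_closed[OF A d(1)] Ac by simp
qed

text \<open>
The sets \<open>A\<close> and \<open>X - A\<close> contribute two further values unless \<open>A\<close> is open or closed, in which case it is
\<open>iA\<close> or \<open>bA\<close>.
\<close>

lemma set_counts:
  assumes A: "A \<subseteq> topspace X" and ne: "topspace X \<noteq> {}"
  shows "k_set X A = fst (tally (pattern X A)) + (if open_or_closed X A then 0 else 2)"
    and "kf_set X A = snd (tally (pattern X A)) + (if open_or_closed X A then 0 else 2)"
proof -
  have gen: "card ({A, topspace X - A} \<union> region_union X A ` set (with_complements cs)) =
      traces cs (pattern X A) + (if open_or_closed X A then 0 else 2)"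
    if sub: "set K_codes \<subseteq> set cs" "set cs \<subseteq> set (K_codes @ F_codes)" for cs
  proof -
    let ?F = "region_union X A ` set (with_complements cs)"
    have card: "card ?F = traces cs (pattern X A)"
      by (rule card_region_unions) (simp add: set_pattern)
    have codes: "set cs \<subseteq> set (with_complements cs)" "complement_code ` set cs \<subseteq> set (with_complements cs)"
      by (auto simp: with_complements_def)
    show ?thesis
    proof (cases "open_or_closed X A")
      case True
      then have "A = region_union X A [Inn] \<or>
          A = region_union X A [Inn, InnThin, InnMix, InnOut, Mix, MixOut, Triple, OutThin]"
        unfolding open_or_closed_def region_union_Inn[OF A] K_region_unions(6)[OF A, symmetric]
        by (metis interior_of_openin closure_of_closedin)
      then obtain c where c: "c \<in> set K_codes" "A = region_union X A c"
        by (auto simp: K_codes_def)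
      then have "c \<in> set (with_complements cs)" "complement_code c \<in> set (with_complements cs)"
        using codes sub(1) by blast+
      then have "A \<in> ?F" "topspace X - A \<in> ?F"
        using c(2) region_union_complement_code[of X A c] by (metis image_eqI)+
      then have "{A, topspace X - A} \<union> ?F = ?F" by blast
      then show ?thesis using True card by simp
    next
      case False
      have "set (with_complements cs) \<subseteq> set (with_complements (K_codes @ F_codes))"
        using sub(2) by (auto simp: with_complements_def)
      then have nA: "A \<noteq> region_union X A c" if "c \<in> set (with_complements cs)" for c
        using union_open_or_closed[OF A ne] that False by blast
      then have 1: "A \<notin> ?F" by blast
      have 2: "topspace X - A \<notin> ?F"
      proof
        assume "topspace X - A \<in> ?F"
        then obtain c where c: "c \<in> set (with_complements cs)" "topspace X - A = region_union X A c" by blast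
        have cc: "region_union X A (complement_code (complement_code d)) = region_union X A d" for d
          unfolding region_union_complement_code by (auto simp: region_union_def)
        from c(1) consider "c \<in> set cs" | d where "d \<in> set cs" "c = complement_code d"
          by (auto simp: with_complements_def)
        then obtain e where "e \<in> set (with_complements cs)" "region_union X A e = topspace X - region_union X A c"
          by cases (use codes cc region_union_complement_code in \<open>metis image_subset_iff subsetD\<close>)+
        moreover have "topspace X - (topspace X - A) = A" using A by blast
        ultimately show False using nA c(2) by metis
      qed
      have 3: "A \<noteq> topspace X - A" using A ne by blast
      have "finite ?F" by simp
      then have "card ({A, topspace X - A} \<union> ?F) = card ?F + 2"
        using 1 2 3 by simp
      then show ?thesis using False card by simp
    qed
  qed
  show "k_set X A = fst (tally (pattern X A)) + (if open_or_closed X A then 0 else 2)"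
    unfolding k_set_def K_ops_values[OF A] by (subst gen) (auto simp: tally_def)
  show "kf_set X A = snd (tally (pattern X A)) + (if open_or_closed X A then 0 else 2)"
    unfolding kf_set_def KF_ops_values[OF A] by (subst gen) (auto simp: tally_def)
qed

section \<open>The regions that occur in a space\<close>

definition swap_region :: "region \<Rightarrow> region" where
  "swap_region r = (case r of Inn \<Rightarrow> Out | InnThin \<Rightarrow> OutThin | InnMix \<Rightarrow> MixOut |
     OutThin \<Rightarrow> InnThin | Out \<Rightarrow> Inn | MixOut \<Rightarrow> InnMix | r \<Rightarrow> r)"

text \<open>
Complementation exchanges the inner and the outer part and preserves the mixed part.
\<close>

lemma region_of_complement:
  assumes A: "A \<subseteq> topspace X" and x: "x \<in> topspace X"
  shows "region_of X (topspace X - A) x = swap_region (region_of X A x)"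
proof -
  let ?C = "topspace X - A"
  have C: "?C \<subseteq> topspace X" by blast
  let ?b = "X closure_of A" and ?i = "X interior_of A"
  have e1: "X closure_of ?C = topspace X - ?i" "X interior_of ?C = topspace X - ?b"
    by (simp_all add: closure_of_complement interior_of_complement)
  have e2: "X interior_of (topspace X - ?i) = topspace X - X closure_of ?i"
      "X closure_of (topspace X - ?b) = topspace X - X interior_of ?b"
    by (simp_all add: closure_of_complement interior_of_complement)
  have e3: "X interior_of (topspace X - X interior_of ?b) = topspace X - X closure_of (X interior_of ?b)"
    "X closure_of (topspace X - X closure_of ?i) = topspace X - X interior_of (X closure_of ?i)"
    by (simp_all add: closure_of_complement interior_of_complement)
  have e4: "(topspace X - X closure_of ?i) - (topspace X - X interior_of ?b) = X interior_of ?b - X closure_of ?i"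
    using interior_of_subset_topspace[of X ?b] by blast
  show ?thesis
    using region_mem[OF A x] region_mem[OF C x] x unfolding e1 e2 e3 e4 swap_region_def
    by (cases "region_of X A x"; cases "region_of X ?C x"; simp)
qed

definition space_regions :: "'a topology \<Rightarrow> region set" where
  "space_regions X = (\<Union>A\<in>Pow (topspace X). regions X A)"

lemma same_op_iff_regions:
  assumes "\<And>A. A \<subseteq> topspace X \<Longrightarrow> p A = region_union X A c" "\<And>A. A \<subseteq> topspace X \<Longrightarrow> q A = region_union X A d"
  shows "same_op X p q \<longleftrightarrow> space_regions X \<inter> ((set c - set d) \<union> (set d - set c)) = {}"
proof -
  have "p A = q A \<longleftrightarrow> regions X A \<inter> ((set c - set d) \<union> (set d - set c)) = {}"
    if "A \<subseteq> topspace X" for A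
    unfolding assms(1)[OF that] assms(2)[OF that] region_union_eq_iff by blast
  then show ?thesis unfolding same_op_def space_regions_def by blast
qed

text \<open>
Two operators agree on a space if and only if no region in the symmetric difference of their codes ever occurs.
\<close>

lemma type_set_iff:
  shows "IB \<in> type_set X \<longleftrightarrow> space_regions X \<inter> {InnOut, MixOut, Triple} = {}"
    and "BI \<in> type_set X \<longleftrightarrow> space_regions X \<inter> {Mix, MixOut} = {}"
    and "B \<in> type_set X \<longleftrightarrow> OutThin \<notin> space_regions X"
proof -
  have bib: "(cl X \<circ> int_op X \<circ> cl X) A = region_union X A [Inn, InnThin, InnMix, InnOut, Mix, MixOut, Triple]"
    if "A \<subseteq> topspace X" for A
    using that by (simp add: K_region_unions(5)[symmetric] cl_eq int_op_closure)
  have ib: "op_of X IB A = region_union X A [Inn, InnThin, InnMix, Mix]" if "A \<subseteq> topspace X" for A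
    using that by (simp add: K_region_unions(4)[symmetric] cl_eq int_op_closure)
  have bi: "op_of X BI A = region_union X A [Inn, InnThin, InnMix, InnOut, Triple]" if "A \<subseteq> topspace X" for A
    using that by (simp add: K_region_unions(3)[OF that, symmetric] cl_eq int_op_eq_interior_of)
  have b: "op_of X B A = region_union X A [Inn, InnThin, InnMix, InnOut, Mix, MixOut, Triple, OutThin]"
    if "A \<subseteq> topspace X" for A
    using that by (simp add: K_region_unions(6)[OF that, symmetric] cl_eq)
  have "IB \<in> type_set X \<longleftrightarrow> same_op X (op_of X IB) (cl X \<circ> int_op X \<circ> cl X)"
    by (simp only: type_set_def mem_Collect_eq)
  also note same_op_iff_regions[OF ib bib]
  finally show "IB \<in> type_set X \<longleftrightarrow> space_regions X \<inter> {InnOut, MixOut, Triple} = {}" by auto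
  have "BI \<in> type_set X \<longleftrightarrow> same_op X (op_of X BI) (cl X \<circ> int_op X \<circ> cl X)"
    by (simp only: type_set_def mem_Collect_eq)
  also note same_op_iff_regions[OF bi bib]
  finally show "BI \<in> type_set X \<longleftrightarrow> space_regions X \<inter> {Mix, MixOut} = {}" by auto
  have "B \<in> type_set X \<longleftrightarrow> same_op X (op_of X B) (cl X \<circ> int_op X \<circ> cl X)"
    by (simp only: type_set_def mem_Collect_eq)
  also note same_op_iff_regions[OF b bib]
  finally show "B \<in> type_set X \<longleftrightarrow> OutThin \<notin> space_regions X" by auto
qed

lemma Mix_closed_iff:
  assumes A: "A \<subseteq> topspace X"
  shows "closedin X (region_union X A [Mix]) \<longleftrightarrow> regions X A \<inter> {InnMix, MixOut, Triple} = {}"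
proof -
  have "region_union X A [Mix] \<subseteq> topspace X" by (auto simp: region_union_def)
  then have "closedin X (region_union X A [Mix]) \<longleftrightarrow> region_union X A [InnMix, Mix, MixOut, Triple] = region_union X A [Mix]"
    by (metis closure_Mix[OF A] closedin_closure_of closure_of_closedin)
  also have "\<dots> \<longleftrightarrow> regions X A \<inter> {InnMix, MixOut, Triple} = {}"
    by (auto simp: region_union_eq_iff)
  finally show ?thesis .
qed

text \<open>
The closure of the mixed part adds to it the boundary points that adhere to it.
\<close>

lemma KD_space_iff:
  "KD_space X \<longleftrightarrow> kuratowski_space X \<and> space_regions X \<inter> {InnMix, MixOut, Triple} = {}"
proof -
  have "openin X (int_op X (bd X A)) \<and> closedin X (int_op X (bd X A)) \<longleftrightarrow>
      regions X A \<inter> {InnMix, MixOut, Triple} = {}" if A: "A \<subseteq> topspace X" for A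
  proof -
    have "int_op X (bd X A) = region_union X A [Mix]" by (simp only: int_bd[OF A] region_union_Mix[OF A])
    moreover have "openin X (region_union X A [Mix])" unfolding region_union_Mix[OF A] by (simp add: openin_diff)
    ultimately show ?thesis using Mix_closed_iff[OF A] by simp
  qed
  then show ?thesis by (auto simp: KD_space_def space_regions_def)
qed

lemma in_space_regions: "A \<subseteq> topspace X \<Longrightarrow> regions X A \<subseteq> space_regions X"
  by (auto simp: space_regions_def)

lemma space_regions_swap: "r \<in> space_regions X \<Longrightarrow> swap_region r \<in> space_regions X"
proof -
  assume "r \<in> space_regions X"
  then obtain A x where "A \<subseteq> topspace X" "x \<in> topspace X" "r = region_of X A x"
    by (auto simp: space_regions_def regions_def)
  then have "topspace X - A \<subseteq> topspace X" "region_of X (topspace X - A) x = swap_region r" "x \<in> topspace X"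
    by (auto simp: region_of_complement)
  then have "swap_region r \<in> regions X (topspace X - A)" by (metis image_eqI regions_def)
  then show ?thesis unfolding space_regions_def by blast
qed

text \<open>
The regions that occur in a space are invariant under the exchange of inner and outer part.
\<close>

lemma space_regions_cases:
  assumes "topspace X \<noteq> {}"
  shows "Triple \<in> space_regions X \<or> InnMix \<in> space_regions X \<or> MixOut \<in> space_regions X \<Longrightarrow> Mix \<in> space_regions X"
    and "InnThin \<in> space_regions X \<longleftrightarrow> OutThin \<in> space_regions X"
    and "InnMix \<in> space_regions X \<longleftrightarrow> MixOut \<in> space_regions X"
proof -
  show "Triple \<in> space_regions X \<or> InnMix \<in> space_regions X \<or> MixOut \<in> space_regions X \<Longrightarrow> Mix \<in> space_regions X"
  proof -
    assume "Triple \<in> space_regions X \<or> InnMix \<in> space_regions X \<or> MixOut \<in> space_regions X"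
    then obtain A where A: "A \<subseteq> topspace X"
        "Triple \<in> regions X A \<or> InnMix \<in> regions X A \<or> MixOut \<in> regions X A"
      unfolding space_regions_def by blast
    then have "Mix \<in> regions X A" using admissible_regions[OF A(1) assms] by (auto simp: admissible_def)
    then show ?thesis using A(1) unfolding space_regions_def by blast
  qed
  have sw: "swap_region InnThin = OutThin" "swap_region OutThin = InnThin"
    "swap_region InnMix = MixOut" "swap_region MixOut = InnMix"
    by (simp_all add: swap_region_def)
  show "InnThin \<in> space_regions X \<longleftrightarrow> OutThin \<in> space_regions X"
    "InnMix \<in> space_regions X \<longleftrightarrow> MixOut \<in> space_regions X"
    by (metis space_regions_swap sw)+
qed

section \<open>Possible counts\<close>

text \<open>
The pairs \<open>(k(A), k\<^sub>f(A))\<close> that are not excluded for a set with pattern \<open>ns\<close>: the first alternative is for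
sets that are neither open nor closed, the second for open or closed sets.
\<close>

definition outcomes :: "region list \<Rightarrow> (nat \<times> nat) list" where
  "outcomes ns =
     (if list_all (\<lambda>r. r \<in> {Inn, Out}) ns then [] else [(fst (tally ns) + 2, snd (tally ns) + 2)]) @
     (if Mix \<in> set ns \<or> InnThin \<in> set ns \<and> OutThin \<in> set ns then [] else [tally ns])"

lemma counts_in_outcomes:
  assumes A: "A \<subseteq> topspace X" and ne: "topspace X \<noteq> {}"
  shows "(k_set X A, kf_set X A) \<in> set (outcomes (pattern X A))"
proof -
  have "regions X A \<subseteq> {Inn, Out} \<longleftrightarrow> list_all (\<lambda>r. r \<in> {Inn, Out}) (pattern X A)"
    using set_pattern[of X A] by (auto simp: list_all_iff)
  then have np: "\<not> open_or_closed X A \<Longrightarrow> \<not> list_all (\<lambda>r. r \<in> {Inn, Out}) (pattern X A)"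
    using regions_open_or_closed(4)[OF A] by blast
  have p: "open_or_closed X A \<Longrightarrow> \<not> (Mix \<in> regions X A \<or> InnThin \<in> regions X A \<and> OutThin \<in> regions X A)"
    using regions_open_or_closed(1-3)[OF A] by (auto simp: open_or_closed_def)
  show ?thesis
  proof (cases "open_or_closed X A")
    case True
    then have "(k_set X A, kf_set X A) = tally (pattern X A)" by (simp add: set_counts[OF A ne])
    then show ?thesis using p[OF True] by (simp only: outcomes_def set_pattern) simp
  next
    case False
    then show ?thesis using np[OF False] by (simp only: set_counts[OF A ne] outcomes_def) simp
  qed
qed

lemma k_spaceE:
  assumes "topspace X \<noteq> {}"
  obtains A where "A \<subseteq> topspace X" "k_space X = k_set X A"
proof -
  have "k_space X \<in> k_set X ` Pow (topspace X)"
    unfolding k_space_def by (rule Max_in[OF finite_k_set_values]) auto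
  then show ?thesis using that by blast
qed

lemma kf_spaceE:
  assumes "topspace X \<noteq> {}"
  obtains A where "A \<subseteq> topspace X" "kf_space X = kf_set X A"
proof -
  have "kf_space X \<in> kf_set X ` Pow (topspace X)"
    unfolding kf_space_def by (rule Max_in[OF finite_kf_set_values]) auto
  then show ?thesis using that by blast
qed

lemma k_space_ge: "A \<subseteq> topspace X \<Longrightarrow> k_set X A \<le> k_space X"
  unfolding k_space_def by (rule Max_ge[OF finite_k_set_values]) auto

lemma kf_space_ge: "A \<subseteq> topspace X \<Longrightarrow> kf_set X A \<le> kf_space X"
  unfolding kf_space_def by (rule Max_ge[OF finite_kf_set_values]) auto

text \<open>
Regions that force many distinct values.
\<close>

lemma outcome_bounds:
  "\<forall>ns \<in> set patterns. \<forall>(k, f) \<in> set (outcomes ns).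
     k \<in> {2, 4, 6, 8, 10, 12, 14} \<and>
     f \<in> {2, 4, 6, 8, 10, 12, 14, 16, 18, 20, 22, 24, 26, 28, 30, 32, 34} \<and>
     (OutThin \<in> set ns \<or> Mix \<in> set ns \<longrightarrow> 4 \<le> k \<and> 4 \<le> f) \<and>
     (InnOut \<in> set ns \<longrightarrow> 4 \<le> k \<and> 8 \<le> f) \<and>
     (MixOut \<in> set ns \<longrightarrow> 8 \<le> k \<and> 10 \<le> f) \<and>
     (InnOut \<in> set ns \<and> Mix \<in> set ns \<longrightarrow> 10 \<le> k \<and> 18 \<le> f) \<and>
     (InnOut \<in> set ns \<and> Mix \<in> set ns \<and> (InnThin \<in> set ns \<or> OutThin \<in> set ns) \<longrightarrow> 22 \<le> f)"
  by code_simp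

text \<open>
The six sets of regions are those that can occur in a space that is, in this order, discrete, partition, EO,
OU, ED or KD.
\<close>

lemma outcome_types:
  "\<forall>ns \<in> set patterns. \<forall>(k, f) \<in> set (outcomes ns).
     (list_all (\<lambda>r. r \<in> {Inn, Out}) ns \<longrightarrow> k = 2 \<and> f \<in> {2, 4}) \<and>
     (list_all (\<lambda>r. r \<in> {Inn, Mix, Out}) ns \<longrightarrow> k \<in> {2, 4, 6} \<and> f \<in> {2, 4, 6, 10}) \<and>
     (list_all (\<lambda>r. r \<in> {Inn, InnThin, OutThin, Out}) ns \<longrightarrow> k \<in> {2, 4, 6, 8} \<and> f \<in> {2, 4, 6, 8, 10, 16}) \<and>
     (list_all (\<lambda>r. r \<in> {Inn, InnThin, InnOut, OutThin, Out}) ns \<longrightarrow>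
        k \<in> {2, 4, 6, 8, 10} \<and> f \<in> {2, 4, 6, 8, 10, 12, 14, 16, 20}) \<and>
     (list_all (\<lambda>r. r \<in> {Inn, InnThin, Mix, OutThin, Out}) ns \<longrightarrow>
        k \<in> {2, 4, 6, 8, 10} \<and> f \<in> {2, 4, 6, 8, 10, 16, 22}) \<and>
     (list_all (\<lambda>r. r \<in> {Inn, InnThin, InnOut, Mix, OutThin, Out}) ns \<longrightarrow>
        f \<in> {2, 4, 6, 8, 10, 12, 14, 16, 18, 20, 22, 28} \<and>
        (f = 20 \<longrightarrow> InnThin \<in> set ns \<and> InnOut \<in> set ns \<and> OutThin \<in> set ns))"
  by code_simp

lemma outcome_12:
  "\<forall>ns \<in> set patterns. \<forall>(k, f) \<in> set (outcomes ns).
     f = 12 \<longrightarrow> snd (tally ns) = 12 \<and> InnOut \<in> set ns \<and> (InnThin \<in> set ns \<or> OutThin \<in> set ns)"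
  by code_simp

lemma counts_bounds:
  assumes "A \<subseteq> topspace X" "topspace X \<noteq> {}"
  shows "k_set X A \<in> {2, 4, 6, 8, 10, 12, 14}"
    and "kf_set X A \<in> {2, 4, 6, 8, 10, 12, 14, 16, 18, 20, 22, 24, 26, 28, 30, 32, 34}"
    and "OutThin \<in> regions X A \<or> Mix \<in> regions X A \<Longrightarrow> 4 \<le> k_set X A \<and> 4 \<le> kf_set X A"
    and "InnOut \<in> regions X A \<Longrightarrow> 4 \<le> k_set X A \<and> 8 \<le> kf_set X A"
    and "MixOut \<in> regions X A \<Longrightarrow> 8 \<le> k_set X A \<and> 10 \<le> kf_set X A"
    and "{InnOut, Mix} \<subseteq> regions X A \<Longrightarrow> 10 \<le> k_set X A \<and> 18 \<le> kf_set X A"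
    and "{InnOut, Mix} \<subseteq> regions X A \<Longrightarrow> InnThin \<in> regions X A \<or> OutThin \<in> regions X A \<Longrightarrow>
           22 \<le> kf_set X A"
proof -
  have "case (k_set X A, kf_set X A) of (k, f) \<Rightarrow>
     k \<in> {2, 4, 6, 8, 10, 12, 14} \<and>
     f \<in> {2, 4, 6, 8, 10, 12, 14, 16, 18, 20, 22, 24, 26, 28, 30, 32, 34} \<and>
     (OutThin \<in> regions X A \<or> Mix \<in> regions X A \<longrightarrow> 4 \<le> k \<and> 4 \<le> f) \<and>
     (InnOut \<in> regions X A \<longrightarrow> 4 \<le> k \<and> 8 \<le> f) \<and>
     (MixOut \<in> regions X A \<longrightarrow> 8 \<le> k \<and> 10 \<le> f) \<and>
     (InnOut \<in> regions X A \<and> Mix \<in> regions X A \<longrightarrow> 10 \<le> k \<and> 18 \<le> f) \<and>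
     (InnOut \<in> regions X A \<and> Mix \<in> regions X A \<and> (InnThin \<in> regions X A \<or> OutThin \<in> regions X A)
        \<longrightarrow> 22 \<le> f)"
    using outcome_bounds[rule_format, OF pattern_in_patterns[OF assms] counts_in_outcomes[OF assms]]
    by (simp only: set_pattern)
  then show "k_set X A \<in> {2, 4, 6, 8, 10, 12, 14}"
    and "kf_set X A \<in> {2, 4, 6, 8, 10, 12, 14, 16, 18, 20, 22, 24, 26, 28, 30, 32, 34}"
    and "OutThin \<in> regions X A \<or> Mix \<in> regions X A \<Longrightarrow> 4 \<le> k_set X A \<and> 4 \<le> kf_set X A"
    and "InnOut \<in> regions X A \<Longrightarrow> 4 \<le> k_set X A \<and> 8 \<le> kf_set X A"
    and "MixOut \<in> regions X A \<Longrightarrow> 8 \<le> k_set X A \<and> 10 \<le> kf_set X A"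
    and "{InnOut, Mix} \<subseteq> regions X A \<Longrightarrow> 10 \<le> k_set X A \<and> 18 \<le> kf_set X A"
    and "{InnOut, Mix} \<subseteq> regions X A \<Longrightarrow> InnThin \<in> regions X A \<or> OutThin \<in> regions X A \<Longrightarrow>
           22 \<le> kf_set X A"
    by (simp_all only: prod.case insert_subset)
qed

lemma counts_by_regions:
  assumes "A \<subseteq> topspace X" "topspace X \<noteq> {}"
  shows "regions X A \<subseteq> {Inn, Out} \<Longrightarrow> k_set X A = 2 \<and> kf_set X A \<in> {2, 4}"
    and "regions X A \<subseteq> {Inn, Mix, Out} \<Longrightarrow> k_set X A \<in> {2, 4, 6} \<and> kf_set X A \<in> {2, 4, 6, 10}"
    and "regions X A \<subseteq> {Inn, InnThin, OutThin, Out} \<Longrightarrow>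
       k_set X A \<in> {2, 4, 6, 8} \<and> kf_set X A \<in> {2, 4, 6, 8, 10, 16}"
    and "regions X A \<subseteq> {Inn, InnThin, InnOut, OutThin, Out} \<Longrightarrow>
       k_set X A \<in> {2, 4, 6, 8, 10} \<and> kf_set X A \<in> {2, 4, 6, 8, 10, 12, 14, 16, 20}"
    and "regions X A \<subseteq> {Inn, InnThin, Mix, OutThin, Out} \<Longrightarrow>
       k_set X A \<in> {2, 4, 6, 8, 10} \<and> kf_set X A \<in> {2, 4, 6, 8, 10, 16, 22}"
    and "regions X A \<subseteq> {Inn, InnThin, InnOut, Mix, OutThin, Out} \<Longrightarrow>
        kf_set X A \<in> {2, 4, 6, 8, 10, 12, 14, 16, 18, 20, 22, 28} \<and>
        (kf_set X A = 20 \<longrightarrow> {InnThin, InnOut, OutThin} \<subseteq> regions X A)"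
proof -
  have L: "list_all (\<lambda>r. r \<in> S) (pattern X A) \<longleftrightarrow> regions X A \<subseteq> S" for S
    using set_pattern[of X A] by (auto simp: list_all_iff)
  have "case (k_set X A, kf_set X A) of (k, f) \<Rightarrow>
     (regions X A \<subseteq> {Inn, Out} \<longrightarrow> k = 2 \<and> f \<in> {2, 4}) \<and>
     (regions X A \<subseteq> {Inn, Mix, Out} \<longrightarrow> k \<in> {2, 4, 6} \<and> f \<in> {2, 4, 6, 10}) \<and>
     (regions X A \<subseteq> {Inn, InnThin, OutThin, Out} \<longrightarrow> k \<in> {2, 4, 6, 8} \<and> f \<in> {2, 4, 6, 8, 10, 16}) \<and>
     (regions X A \<subseteq> {Inn, InnThin, InnOut, OutThin, Out} \<longrightarrow>
        k \<in> {2, 4, 6, 8, 10} \<and> f \<in> {2, 4, 6, 8, 10, 12, 14, 16, 20}) \<and>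
     (regions X A \<subseteq> {Inn, InnThin, Mix, OutThin, Out} \<longrightarrow>
        k \<in> {2, 4, 6, 8, 10} \<and> f \<in> {2, 4, 6, 8, 10, 16, 22}) \<and>
     (regions X A \<subseteq> {Inn, InnThin, InnOut, Mix, OutThin, Out} \<longrightarrow>
        f \<in> {2, 4, 6, 8, 10, 12, 14, 16, 18, 20, 22, 28} \<and>
        (f = 20 \<longrightarrow> InnThin \<in> regions X A \<and> InnOut \<in> regions X A \<and> OutThin \<in> regions X A))"
    using outcome_types[rule_format, OF pattern_in_patterns[OF assms] counts_in_outcomes[OF assms]]
    by (simp only: set_pattern L)
  then show "regions X A \<subseteq> {Inn, Out} \<Longrightarrow> k_set X A = 2 \<and> kf_set X A \<in> {2, 4}"
    and "regions X A \<subseteq> {Inn, Mix, Out} \<Longrightarrow> k_set X A \<in> {2, 4, 6} \<and> kf_set X A \<in> {2, 4, 6, 10}"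
    and "regions X A \<subseteq> {Inn, InnThin, OutThin, Out} \<Longrightarrow>
       k_set X A \<in> {2, 4, 6, 8} \<and> kf_set X A \<in> {2, 4, 6, 8, 10, 16}"
    and "regions X A \<subseteq> {Inn, InnThin, InnOut, OutThin, Out} \<Longrightarrow>
       k_set X A \<in> {2, 4, 6, 8, 10} \<and> kf_set X A \<in> {2, 4, 6, 8, 10, 12, 14, 16, 20}"
    and "regions X A \<subseteq> {Inn, InnThin, Mix, OutThin, Out} \<Longrightarrow>
       k_set X A \<in> {2, 4, 6, 8, 10} \<and> kf_set X A \<in> {2, 4, 6, 8, 10, 16, 22}"
    and "regions X A \<subseteq> {Inn, InnThin, InnOut, Mix, OutThin, Out} \<Longrightarrow>
        kf_set X A \<in> {2, 4, 6, 8, 10, 12, 14, 16, 18, 20, 22, 28} \<and>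
        (kf_set X A = 20 \<longrightarrow> {InnThin, InnOut, OutThin} \<subseteq> regions X A)"
    by (simp_all only: prod.case insert_subset empty_subsetI simp_thms) (elim conjE, assumption)
qed

text \<open>
By the table, \<open>A\<close> is open with a nonempty region \<open>InnThin\<close>, or closed with a nonempty region \<open>OutThin\<close>, and
inner and outer points adhere to one another in a set \<open>N\<close>. In the first case \<open>N\<close> is added to \<open>A\<close>, in the
second it is removed. This changes neither the interior nor the closure of \<open>A\<close>, on which the regions
depend, but the new set is neither open nor closed, so that two more values arise.
\<close>

lemma kf_set_12_improves:
  assumes A: "A \<subseteq> topspace X" and ne: "topspace X \<noteq> {}" and kf: "kf_set X A = 12"
  shows "\<exists>A' \<subseteq> topspace X. kf_set X A' = 14"
proof -
  let ?N = "region_union X A [InnOut]"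
  have "snd (tally (pattern X A)) = 12 \<and> InnOut \<in> regions X A \<and>
      (InnThin \<in> regions X A \<or> OutThin \<in> regions X A)"
    using outcome_12[rule_format, OF pattern_in_patterns[OF A ne] counts_in_outcomes[OF A ne]] kf
    by (simp add: set_pattern)
  then have t: "snd (tally (pattern X A)) = 12" and N: "?N \<noteq> {}"
    and thin: "InnThin \<in> regions X A \<or> OutThin \<in> regions X A"
    by (auto simp: region_union_empty_iff)
  then have "open_or_closed X A" using set_counts(2)[OF A ne] kf by (auto split: if_splits)
  then consider "openin X A" "InnThin \<in> regions X A" | "closedin X A" "OutThin \<in> regions X A"
    using thin regions_open_or_closed(1,2)[OF A] by (auto simp: open_or_closed_def)
  then obtain A' where A': "A' \<subseteq> topspace X" "X interior_of A' = X interior_of A"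
    "X closure_of A' = X closure_of A" and np: "\<not> open_or_closed X A'"
  proof cases
    case 1
    have iA: "X interior_of A = A" using 1(1) by (simp add: interior_of_openin)
    have Nbi: "A \<union> ?N \<subseteq> X closure_of A"
      using closure_of_subset[OF A] unfolding K_region_unions(6)[OF A] by (auto simp: region_union_def)
    have cl: "X closure_of (A \<union> ?N) = X closure_of A"
      using closure_of_mono[of A "A \<union> ?N" X] closure_of_minimal[OF Nbi closedin_closure_of] by auto
    have "X interior_of (A \<union> ?N) \<subseteq> X interior_of (X closure_of (X interior_of A))"
      using interior_of_mono[OF Nbi, of X] iA by simp
    moreover have "X interior_of (X closure_of (X interior_of A)) \<inter> ?N = {}"
      unfolding K_region_unions(2)[OF A] by (auto simp: region_union_def)
    ultimately have "X interior_of (A \<union> ?N) \<subseteq> A" using interior_of_subset[of X "A \<union> ?N"] by blast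
    then have int: "X interior_of (A \<union> ?N) = X interior_of A"
      using interior_of_mono[of A "A \<union> ?N" X] iA by auto
    have sub: "A \<union> ?N \<subseteq> topspace X" using A by (auto simp: region_union_def)
    have AI: "region_union X A [Inn] = A" using region_union_Inn[OF A] iA by simp
    have "?N \<inter> region_union X A [Inn] = {}" by (auto simp: region_union_def)
    then have "?N \<inter> A = {}" by (simp only: AI)
    then have "\<not> openin X (A \<union> ?N)" using int iA N interior_of_openin by blast
    moreover have "\<not> closedin X (A \<union> ?N)"
    proof
      assume "closedin X (A \<union> ?N)"
      then have "X closure_of A = region_union X A [Inn] \<union> ?N" using cl closure_of_closedin AI by metis
      also have "\<dots> = region_union X A [Inn, InnOut]" by (auto simp: region_union_def)
      finally have "region_union X A [Inn, InnThin, InnMix, InnOut, Mix, MixOut, Triple, OutThin] = region_union X A [Inn, InnOut]"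
        unfolding K_region_unions(6)[OF A] .
      then show False using 1(2) by (auto simp: region_union_eq_iff)
    qed
    ultimately show ?thesis using that[OF sub int cl] by (auto simp: open_or_closed_def)
  next
    case 2
    have bA: "X closure_of A = A" using 2(1) by (simp add: closure_of_closedin)
    have "X interior_of A \<inter> ?N = {}" unfolding region_union_Inn[OF A, symmetric] by (auto simp: region_union_def)
    then have iN: "X interior_of A \<subseteq> A - ?N" using interior_of_subset[of X A] by blast
    have int: "X interior_of (A - ?N) = X interior_of A"
      using interior_of_mono[of "A - ?N" A X] interior_of_maximal[OF iN openin_interior_of] by auto
    have "?N \<subseteq> X closure_of (X interior_of A)"
      unfolding K_region_unions(3)[OF A] by (auto simp: region_union_def)
    then have "?N \<subseteq> X closure_of (A - ?N)" using closure_of_mono[OF iN, of X] by blast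
    moreover have "A - ?N \<subseteq> X closure_of (A - ?N)" using A by (intro closure_of_subset) blast
    ultimately have cl: "X closure_of (A - ?N) = X closure_of A"
      using closure_of_mono[of "A - ?N" A X] bA by auto
    have sub: "A - ?N \<subseteq> topspace X" using A by blast
    have "?N \<subseteq> X closure_of A" unfolding K_region_unions(6)[OF A] by (auto simp: region_union_def)
    then have NA: "?N \<subseteq> A" by (simp only: bA)
    then have "\<not> closedin X (A - ?N)" using cl bA N closure_of_closedin by blast
    moreover have "\<not> openin X (A - ?N)"
    proof
      assume "openin X (A - ?N)"
      then have "X interior_of A = A - ?N" using int interior_of_openin by metis
      then have "X closure_of A = X interior_of A \<union> ?N" using bA NA by auto
      also have "\<dots> = region_union X A [Inn, InnOut]" unfolding region_union_Inn[OF A, symmetric] by (auto simp: region_union_def)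
      finally have "region_union X A [Inn, InnThin, InnMix, InnOut, Mix, MixOut, Triple, OutThin] = region_union X A [Inn, InnOut]"
        unfolding K_region_unions(6)[OF A] .
      then show False using 2(2) by (auto simp: region_union_eq_iff)
    qed
    ultimately show ?thesis using that[OF sub int cl] by (auto simp: open_or_closed_def)
  qed
  have "region_of X A' = region_of X A" by (simp add: region_of_def A' fun_eq_iff)
  then have "pattern X A' = pattern X A" by (simp add: pattern_def regions_def)
  then have "kf_set X A' = 14" using set_counts(2)[OF A'(1) ne] np t by simp
  then show ?thesis using A'(1) by blast
qed

lemma kf_space_not_12:
  assumes "topspace X \<noteq> {}"
  shows "kf_space X \<noteq> 12"
proof
  assume eq: "kf_space X = 12"
  obtain A where "A \<subseteq> topspace X" "kf_set X A = 12" using kf_spaceE[OF assms] eq by metis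
  then obtain A' where "A' \<subseteq> topspace X" "kf_set X A' = 14" using kf_set_12_improves assms by metis
  then show False using kf_space_ge[of A' X] eq by simp
qed

section \<open>Kuratowski spaces\<close>

text \<open>
Interior and closure are determined locally, in the sense that their traces on an open set \<open>C\<close> depend only on
the trace of \<open>A\<close> on \<open>C\<close>.
\<close>

lemma region_of_local:
  assumes C: "openin X C" and eq: "A \<inter> C = A' \<inter> C" and x: "x \<in> C"
  shows "region_of X A x = region_of X A' x"
proof -
  have cl: "X closure_of S \<inter> C = X closure_of S' \<inter> C" if "S \<inter> C = S' \<inter> C" for S S'
  proof -
    have local: "X closure_of T \<inter> C = X closure_of (C \<inter> T) \<inter> C" for T
    proof -
      have "C \<inter> X closure_of T \<subseteq> X closure_of (C \<inter> T)" by (rule openin_Int_closure_of_subset[OF C])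
      moreover have "X closure_of (C \<inter> T) \<subseteq> X closure_of T" by (rule closure_of_mono) blast
      ultimately show ?thesis by blast
    qed
    have "C \<inter> S = C \<inter> S'" using that by blast
    then show ?thesis using local[of S] local[of S'] by simp
  qed
  have int: "X interior_of S \<inter> C = X interior_of S' \<inter> C" if "S \<inter> C = S' \<inter> C" for S S'
  proof -
    have "X interior_of S \<inter> C = X interior_of (S \<inter> C)" "X interior_of S' \<inter> C = X interior_of (S' \<inter> C)"
      by (simp_all add: interior_of_Int interior_of_openin[OF C])
    then show ?thesis using that by simp
  qed
  let ?b = "\<lambda>S. X closure_of S" and ?i = "\<lambda>S. X interior_of S"
  have e: "?b A \<inter> C = ?b A' \<inter> C" "?i A \<inter> C = ?i A' \<inter> C" by (rule cl[OF eq], rule int[OF eq])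
  have e2: "?b (?i A) \<inter> C = ?b (?i A') \<inter> C" "?i (?b A) \<inter> C = ?i (?b A') \<inter> C"
    by (rule cl[OF e(2)], rule int[OF e(1)])
  have e3: "?i (?b (?i A)) \<inter> C = ?i (?b (?i A')) \<inter> C" "?b (?i (?b A)) \<inter> C = ?b (?i (?b A')) \<inter> C"
    by (rule int[OF e2(1)], rule cl[OF e2(2)])
  have "(?i (?b A) - ?b (?i A)) \<inter> C = (?i (?b A') - ?b (?i A')) \<inter> C" using e2 by blast
  then have e4: "?b (?i (?b A) - ?b (?i A)) \<inter> C = ?b (?i (?b A') - ?b (?i A')) \<inter> C" by (rule cl)
  have mem: "x \<in> S \<longleftrightarrow> x \<in> S'" if "S \<inter> C = S' \<inter> C" for S S'
  proof -
    have "x \<in> S \<longleftrightarrow> x \<in> S \<inter> C" "x \<in> S' \<longleftrightarrow> x \<in> S' \<inter> C" using x by simp_all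
    then show ?thesis by (simp only: that)
  qed
  show ?thesis
    unfolding region_of_def Let_def mem[OF e(1)] mem[OF e(2)] mem[OF e2(1)] mem[OF e2(2)]
      mem[OF e3(1)] mem[OF e3(2)] mem[OF e4] by (rule refl)
qed

text \<open>
The witness is the trace of \<open>A\<close> on its mixed part \<open>U\<close>. It has empty interior, and its closure is \<open>bU\<close>. Since
\<open>U\<close> is regular open, its mixed part is \<open>ibU = U\<close> again; so the points of \<open>bU - U\<close>, of which there are some by
assumption, adhere to the mixed and the outer part but not to the inner part.
\<close>

lemma MixOut_arises:
  assumes A: "A \<subseteq> topspace X" and r: "regions X A \<inter> {InnMix, MixOut, Triple} \<noteq> {}"
  shows "\<exists>B \<subseteq> topspace X. MixOut \<in> regions X B"
proof -
  let ?i = "X interior_of A" and ?b = "X closure_of A"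
  let ?U = "region_union X A [Mix]"
  let ?B = "A \<inter> ?U"
  have U: "openin X ?U" unfolding region_union_Mix[OF A] by (simp add: openin_diff)
  obtain x where x: "x \<in> topspace X" "x \<in> X closure_of ?U" "x \<notin> ?U"
    using r unfolding closure_Mix[OF A] by (auto simp: region_union_def regions_def)
  have Ub: "?U \<subseteq> ?b" and Ui: "?U \<inter> X closure_of ?i = {}"
    unfolding K_region_unions(3,6)[OF A] by (auto simp: region_union_def)
  have iB: "X interior_of ?B = {}"
  proof -
    have "X interior_of ?B \<subseteq> ?i \<inter> ?U"
      using interior_of_mono[of ?B A X] interior_of_subset[of X ?B] by auto
    moreover have "?i \<inter> ?U = {}"
      unfolding region_union_Inn[OF A, symmetric] by (auto simp: region_union_def)
    ultimately show ?thesis by blast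
  qed
  have bB: "X closure_of ?B = X closure_of ?U"
  proof
    show "X closure_of ?B \<subseteq> X closure_of ?U" by (rule closure_of_mono) blast
    have "?U \<subseteq> X closure_of ?B"
      using openin_Int_closure_of_subset[OF U, of A] Ub by (auto simp: Int_commute)
    then show "X closure_of ?U \<subseteq> X closure_of ?B" by (simp add: closure_of_minimal)
  qed
  \<comment> \<open>The mixed part is regular open.\<close>
  have reg: "X interior_of (X closure_of ?U) \<subseteq> ?U"
  proof -
    let ?V = "X interior_of (X closure_of ?U)"
    have "X closure_of ?U \<subseteq> ?b" using Ub by (simp add: closure_of_minimal)
    then have 1: "?V \<subseteq> X interior_of ?b" by (rule interior_of_mono)
    have "?i \<inter> X closure_of ?U = {}"
      using openin_Int_closure_of_eq_empty[OF openin_interior_of, of X A ?U] Ui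
        closure_of_subset[of ?i X] interior_of_subset_topspace[of X A] by blast
    then have "?V \<inter> ?i = {}" using interior_of_subset[of X "X closure_of ?U"] by blast
    then have "?V \<inter> X closure_of ?i = {}" by (simp add: openin_Int_closure_of_eq_empty)
    with 1 show ?thesis unfolding region_union_Mix[OF A] by blast
  qed
  have B: "?B \<subseteq> topspace X" using A by blast
  have "x \<notin> X interior_of (X closure_of ?U)" using reg x by blast
  moreover have "?U \<subseteq> X interior_of (X closure_of ?U)"
    using U by (simp add: interior_of_maximal closure_of_subset openin_subset)
  then have "x \<in> X closure_of (X interior_of (X closure_of ?U))"
    using closure_of_mono[of ?U _ X] x by blast
  ultimately have "region_of X ?B x = MixOut"
    by (simp add: region_of_def iB bB)
  then have "MixOut \<in> regions X ?B" using x by (force simp: regions_def)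
  then show ?thesis using B by blast
qed

text \<open>
On a clopen piece \<open>D\<close> of the mixed part of \<open>V\<close>, the set \<open>A\<close> can be replaced by \<open>V\<close>. This produces mixed
points, and the regions of the points outside \<open>D\<close> do not change.
\<close>

lemma KD_splice:
  assumes A: "A \<subseteq> topspace X" and V: "V \<subseteq> topspace X"
    and D: "openin X D" "closedin X D" "D \<subseteq> region_union X V [Mix]" "D \<noteq> {}"
  obtains A' where "A' \<subseteq> topspace X" "region_of X A ` (topspace X - D) \<subseteq> regions X A'"
    "Mix \<in> regions X A'"
proof -
  define A' where "A' = (A - D) \<union> (V \<inter> D)"
  have sub: "A' \<subseteq> topspace X" using A V by (auto simp: A'_def)
  have "region_of X A x \<in> regions X A'" if "x \<in> topspace X - D" for x
  proof -
    have "openin X (topspace X - D)" using D(2) by blast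
    moreover have "A \<inter> (topspace X - D) = A' \<inter> (topspace X - D)" by (auto simp: A'_def)
    ultimately have "region_of X A x = region_of X A' x" using that by (rule region_of_local)
    then show ?thesis using that by (simp add: regions_def)
  qed
  moreover have "Mix \<in> regions X A'"
  proof -
    obtain x where x: "x \<in> D" using D(4) by blast
    have "V \<inter> D = A' \<inter> D" by (auto simp: A'_def)
    then have "region_of X V x = region_of X A' x" using D(1) x by (intro region_of_local)
    moreover have "region_of X V x = Mix" "x \<in> topspace X" using x D(3) by (auto simp: region_union_def)
    ultimately show ?thesis by (force simp: regions_def)
  qed
  ultimately show ?thesis using that[OF sub] by blast
qed

text \<open>
Let \<open>W\<close> be an open subset of the mixed part of \<open>V\<close>. The trace of \<open>V\<close> on \<open>W\<close> has empty interior and is dense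
in \<open>W\<close>, so its mixed part is \<open>ibW\<close>. In a KD space this set is clopen, which makes \<open>bW\<close> open. Taking for
\<open>W\<close> the trace of \<open>iA\<close> on the mixed part of \<open>V\<close> shows that there \<open>biA\<close> is contained in \<open>ibiA\<close>.
\<close>

lemma KD_no_InnOut_in_Mix:
  assumes KD: "space_regions X \<inter> {InnMix, MixOut, Triple} = {}"
    and A: "A \<subseteq> topspace X" and V: "V \<subseteq> topspace X"
  shows "region_union X V [Mix] \<inter> X closure_of (X interior_of A) \<subseteq> X interior_of (X closure_of (X interior_of A))"
proof -
  let ?U = "region_union X V [Mix]" and ?i = "X interior_of A"
  have U: "openin X ?U" unfolding region_union_Mix[OF V] by (simp add: openin_diff)
  define W where "W = ?U \<inter> ?i"
  have W: "openin X W" "W \<subseteq> ?U" using U by (auto simp: W_def)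
  let ?C = "V \<inter> W"
  have C: "?C \<subseteq> topspace X" using V by blast
  have "W \<subseteq> X closure_of V" using W(2) unfolding K_region_unions(6)[OF V] by (auto simp: region_union_def)
  then have "W \<subseteq> X closure_of ?C" using openin_Int_closure_of_subset[OF W(1), of V] by (auto simp: Int_commute)
  then have bC: "X closure_of ?C = X closure_of W"
    by (intro subset_antisym closure_of_mono closure_of_minimal) auto
  have "X interior_of ?C \<subseteq> X interior_of V \<inter> ?U"
    using interior_of_mono[of ?C V X] interior_of_subset[of X ?C] W(2) by auto
  also have "\<dots> = {}" unfolding region_union_Inn[OF V, symmetric] by (auto simp: region_union_def)
  finally have iC: "X interior_of ?C = {}" by blast
  have "regions X ?C \<inter> {InnMix, MixOut, Triple} = {}" using KD in_space_regions[OF C] by blast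
  then have "closedin X (region_union X ?C [Mix])" using Mix_closed_iff[OF C] by blast
  then have "closedin X (X interior_of (X closure_of W))" unfolding region_union_Mix[OF C] iC bC by simp
  moreover have "W \<subseteq> X interior_of (X closure_of W)"
    using W(1) by (simp add: interior_of_maximal closure_of_subset openin_subset)
  ultimately have cW: "X closure_of W \<subseteq> X interior_of (X closure_of W)" by (simp add: closure_of_minimal)
  have "?U \<inter> X closure_of ?i \<subseteq> X closure_of W"
    unfolding W_def by (rule openin_Int_closure_of_subset[OF U])
  also have "\<dots> \<subseteq> X interior_of (X closure_of ?i)"
    using cW interior_of_mono[OF closure_of_mono[of W ?i X], of X] by (auto simp: W_def)
  finally show ?thesis .
qed

text \<open>
A KD space has a set \<open>A\<close> in which inner and outer points adhere to one another, and a set \<open>V\<close> with nonempty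
mixed part \<open>U\<close>. The former adherence takes place outside \<open>U\<close>, so both phenomena occur for the set obtained by
splicing \<open>V\<close> into \<open>A\<close> on \<open>U\<close>; this gives 18 values. If a set \<open>S\<close> has 20 values then, by the table, both of
its thin regions are nonempty, and one of them survives if \<open>V\<close> is spliced into \<open>S\<close> on a suitable part of \<open>U\<close>;
the resulting set has at least 22 values.
\<close>

lemma KD_space_bounds:
  assumes ne: "topspace X \<noteq> {}" and KD: "KD_space X"
  shows "10 \<le> k_space X" and "18 \<le> kf_space X" and "kf_space X \<noteq> 20"
proof -
  have kd: "space_regions X \<inter> {InnMix, MixOut, Triple} = {}" and kur: "type_set X = {}"
    using KD by (simp_all add: KD_space_iff kuratowski_space_def)
  have "InnOut \<in> space_regions X" "Mix \<in> space_regions X"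
    using kur kd type_set_iff(1,2)[of X] by auto
  then obtain A V where A: "A \<subseteq> topspace X" "InnOut \<in> regions X A"
    and V: "V \<subseteq> topspace X" "Mix \<in> regions X V" unfolding space_regions_def by blast
  let ?U = "region_union X V [Mix]"
  have U: "openin X ?U" "closedin X ?U" "?U \<noteq> {}"
  proof -
    show "openin X ?U" unfolding region_union_Mix[OF V(1)] by (simp add: openin_diff)
    show "closedin X ?U" using Mix_closed_iff[OF V(1)] in_space_regions[OF V(1)] kd by blast
    show "?U \<noteq> {}" using V(2) by (simp add: region_union_empty_iff)
  qed
  have inn: "region_of X S x \<in> {Inn, InnThin}"
    if S: "S \<subseteq> topspace X" and x: "x \<in> ?U" "region_of X S x \<in> {Inn, InnThin, InnOut}" for S x
  proof -
    have xt: "x \<in> topspace X" using x by (simp add: region_union_def)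
    have "x \<in> X closure_of (X interior_of S)" using region_mem(3)[OF S xt] x(2) by auto
    then have "x \<in> X interior_of (X closure_of (X interior_of S))"
      using KD_no_InnOut_in_Mix[OF kd S V(1)] x(1) by blast
    then show ?thesis using region_mem(2)[OF S xt] by auto
  qed
  have out: "InnOut \<in> region_of X S ` (topspace X - ?U)" if S: "S \<subseteq> topspace X" "InnOut \<in> regions X S" for S
  proof -
    obtain x where x: "x \<in> topspace X" "region_of X S x = InnOut" using S(2) by (auto simp: regions_def)
    then have "x \<notin> ?U" using inn[OF S(1), of x] by auto
    then show ?thesis using x by force
  qed
  obtain A' where A': "A' \<subseteq> topspace X" "region_of X A ` (topspace X - ?U) \<subseteq> regions X A'"
      "Mix \<in> regions X A'"
    by (rule KD_splice[OF A(1) V(1) U(1,2) subset_refl U(3)])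
  then have "{InnOut, Mix} \<subseteq> regions X A'" using out[OF A] by blast
  then show "10 \<le> k_space X" "18 \<le> kf_space X"
    using counts_bounds(6)[OF A'(1) ne] k_space_ge[OF A'(1)] kf_space_ge[OF A'(1)] by linarith+
  show "kf_space X \<noteq> 20"
  proof
    assume eq: "kf_space X = 20"
    then obtain S where S: "S \<subseteq> topspace X" "kf_set X S = 20" using kf_spaceE[OF ne] by metis
    have "InnMix \<notin> regions X S" "MixOut \<notin> regions X S" "Triple \<notin> regions X S"
      using kd in_space_regions[OF S(1)] by blast+
    then have "regions X S \<subseteq> {Inn, InnThin, InnOut, Mix, OutThin, Out}"
      using UNIV_region by (auto simp: all_regions_def)
    then have all: "InnThin \<in> regions X S" "InnOut \<in> regions X S" "OutThin \<in> regions X S"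
      using counts_by_regions(6)[OF S(1) ne] S(2) by auto
    let ?bi = "X closure_of (X interior_of S)" and ?ibi = "X interior_of (X closure_of (X interior_of S))"
    let ?D = "?U - ?bi"
    have "\<exists>S' \<subseteq> topspace X. {InnOut, Mix} \<subseteq> regions X S' \<and> (InnThin \<in> regions X S' \<or> OutThin \<in> regions X S')"
    \<comment> \<open>Splicing on \<open>U - biS\<close> keeps \<open>InnThin\<close>; if this set is empty then \<open>OutThin\<close> is disjoint from \<open>U\<close>.\<close>
    proof (cases "?D = {}")
      case False
      have oD: "openin X ?D" using U(1) by (simp add: openin_diff)
      have D_ibi: "?D = ?U - ?ibi"
        using KD_no_InnOut_in_Mix[OF kd S(1) V(1)] interior_of_subset[of X ?bi] by blast
      have cD: "closedin X ?D" unfolding D_ibi using U(2) by (simp add: closedin_diff)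
      have sD: "?D \<subseteq> ?U" by blast
      obtain S' where S': "S' \<subseteq> topspace X" "region_of X S ` (topspace X - ?D) \<subseteq> regions X S'"
          "Mix \<in> regions X S'"
        by (rule KD_splice[OF S(1) V(1) oD cD sD False])
      obtain y where y: "y \<in> topspace X" "region_of X S y = InnThin" using all(1) by (auto simp: regions_def)
      obtain z where z: "z \<in> topspace X" "region_of X S z = InnOut" using all(2) by (auto simp: regions_def)
      have "y \<notin> ?D" "z \<notin> ?D" using region_mem(3)[OF S(1)] y z by auto
      then have "InnThin \<in> regions X S'" "InnOut \<in> regions X S'" using S'(2) y z by force+
      then show ?thesis using S' by blast
    next
      case True
      obtain S' where S': "S' \<subseteq> topspace X" "region_of X S ` (topspace X - ?U) \<subseteq> regions X S'"
          "Mix \<in> regions X S'"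
        by (rule KD_splice[OF S(1) V(1) U(1,2) subset_refl U(3)])
      obtain z where z: "z \<in> topspace X" "region_of X S z = OutThin" using all(3) by (auto simp: regions_def)
      then have "z \<notin> ?U" using True region_mem(3)[OF S(1), of z] by auto
      then have "OutThin \<in> regions X S'" using S'(2) z by force
      then show ?thesis using S' out[OF S(1) all(2)] by blast
    qed
    then obtain S' where S': "S' \<subseteq> topspace X" "{InnOut, Mix} \<subseteq> regions X S'"
        "InnThin \<in> regions X S' \<or> OutThin \<in> regions X S'" by blast
    then show False using counts_bounds(7)[OF S'(1) ne S'(2,3)] kf_space_ge[OF S'(1)] eq by linarith
  qed
qed

section \<open>Bounds for each type of space\<close>

lemma space_counts:
  assumes ne: "topspace X \<noteq> {}"
    and K: "\<And>A. A \<subseteq> topspace X \<Longrightarrow> k_set X A \<in> S" and F: "\<And>A. A \<subseteq> topspace X \<Longrightarrow> kf_set X A \<in> T"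
  shows "k_space X \<in> S \<and> kf_space X \<in> T"
  using k_spaceE[OF ne] kf_spaceE[OF ne] K F by metis

lemma regions_subset_if:
  assumes "space_regions X \<subseteq> S" "A \<subseteq> topspace X"
  shows "regions X A \<subseteq> S"
  using assms in_space_regions[of A X] by blast

lemma space_counts_ge:
  assumes "r \<in> space_regions X" "\<And>A. A \<subseteq> topspace X \<Longrightarrow> r \<in> regions X A \<Longrightarrow> k \<le> k_set X A \<and> f \<le> kf_set X A"
  shows "k \<le> k_space X \<and> f \<le> kf_space X"
proof -
  obtain A where "A \<subseteq> topspace X" "r \<in> regions X A" using assms(1) unfolding space_regions_def by blast
  then show ?thesis using assms(2)[of A] k_space_ge[of A X] kf_space_ge[of A X] by linarith
qed

lemma region_exhaustive: "r \<in> {Inn, InnThin, InnMix, InnOut, Mix, MixOut, Triple, OutThin, Out}"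
  using UNIV_region unfolding all_regions_def by auto

lemma GE_counts:
  assumes ne: "topspace X \<noteq> {}" and T: "GE_space X"
  shows "k_space X \<in> {8, 10, 12, 14}"
    and "kf_space X \<in> {10} \<union> {14, 16, 18, 20, 22, 24, 26, 28, 30, 32, 34}"
proof -
  have "k_space X \<in> {2, 4, 6, 8, 10, 12, 14} \<and>
     kf_space X \<in> {2, 4, 6, 8, 10, 12, 14, 16, 18, 20, 22, 24, 26, 28, 30, 32, 34}"
    by (rule space_counts[OF ne]) (fact counts_bounds(1,2)[OF _ ne])+
  moreover have "kuratowski_space X" "\<not> KD_space X" using T by (simp_all add: GE_space_def)
  then have "space_regions X \<inter> {InnMix, MixOut, Triple} \<noteq> {}" by (simp add: KD_space_iff)
  then obtain A where "A \<subseteq> topspace X" "regions X A \<inter> {InnMix, MixOut, Triple} \<noteq> {}"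
    unfolding space_regions_def by blast
  then have "MixOut \<in> space_regions X"
    using MixOut_arises[of A X] unfolding space_regions_def by blast
  then have "8 \<le> k_space X \<and> 10 \<le> kf_space X"
    by (rule space_counts_ge) (use counts_bounds(5)[OF _ ne] in blast)
  ultimately show "k_space X \<in> {8, 10, 12, 14}"
    and "kf_space X \<in> {10} \<union> {14, 16, 18, 20, 22, 24, 26, 28, 30, 32, 34}"
    using kf_space_not_12[OF ne] by auto
qed

lemma KD_counts:
  assumes ne: "topspace X \<noteq> {}" and T: "KD_space X"
  shows "k_space X \<in> {10, 12, 14}" and "kf_space X \<in> {18, 22, 28}"
proof -
  have "space_regions X \<inter> {InnMix, MixOut, Triple} = {}" using T by (simp add: KD_space_iff)
  then have "space_regions X \<subseteq> {Inn, InnThin, InnOut, Mix, OutThin, Out}" using region_exhaustive by blast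
  then have R: "regions X A \<subseteq> {Inn, InnThin, InnOut, Mix, OutThin, Out}" if "A \<subseteq> topspace X" for A
    using that by (rule regions_subset_if)
  have "k_space X \<in> {2, 4, 6, 8, 10, 12, 14} \<and>
     kf_space X \<in> {2, 4, 6, 8, 10, 12, 14, 16, 18, 20, 22, 28}"
    by (rule space_counts[OF ne]) (use counts_bounds(1)[OF _ ne] counts_by_regions(6)[OF _ ne R] in blast)+
  then show "k_space X \<in> {10, 12, 14}" and "kf_space X \<in> {18, 22, 28}"
    using KD_space_bounds[OF ne T] by auto
qed

lemma ED_counts:
  assumes ne: "topspace X \<noteq> {}" and T: "ED_space X"
  shows "k_space X \<in> {4, 6, 8, 10}" and "kf_space X \<in> {4, 6, 8, 10, 16, 22}"
proof -
  have "IB \<in> type_set X" "BI \<notin> type_set X" using T by (simp_all add: ED_space_def)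
  then have no: "space_regions X \<inter> {InnOut, MixOut, Triple} = {}" and Mix: "Mix \<in> space_regions X"
    using type_set_iff(1,2)[of X] by auto
  have "InnMix \<notin> space_regions X" using no space_regions_cases(3)[OF ne] by blast
  then have "space_regions X \<subseteq> {Inn, InnThin, Mix, OutThin, Out}" using no region_exhaustive by blast
  then have R: "regions X A \<subseteq> {Inn, InnThin, Mix, OutThin, Out}" if "A \<subseteq> topspace X" for A
    using that by (rule regions_subset_if)
  have "k_space X \<in> {2, 4, 6, 8, 10} \<and> kf_space X \<in> {2, 4, 6, 8, 10, 16, 22}"
    by (rule space_counts[OF ne]) (use counts_by_regions(5)[OF _ ne R] in blast)+
  moreover have "4 \<le> k_space X \<and> 4 \<le> kf_space X"
    by (rule space_counts_ge[OF Mix]) (use counts_bounds(3)[OF _ ne] in blast)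
  ultimately show "k_space X \<in> {4, 6, 8, 10}" and "kf_space X \<in> {4, 6, 8, 10, 16, 22}" by auto
qed

lemma OU_counts:
  assumes ne: "topspace X \<noteq> {}" and T: "OU_space X"
  shows "k_space X \<in> {4, 6, 8, 10}" and "kf_space X \<in> {8, 10, 14, 16, 20}"
proof -
  have "BI \<in> type_set X" "IB \<notin> type_set X" using T by (simp_all add: OU_space_def)
  then have no: "Mix \<notin> space_regions X" "MixOut \<notin> space_regions X"
    and io: "space_regions X \<inter> {InnOut, MixOut, Triple} \<noteq> {}"
    using type_set_iff(1,2)[of X] by auto
  have no': "InnMix \<notin> space_regions X" "Triple \<notin> space_regions X"
    using no space_regions_cases(1)[OF ne] by blast+
  have InnOut: "InnOut \<in> space_regions X" using io no no' by blast
  have "space_regions X \<subseteq> {Inn, InnThin, InnOut, OutThin, Out}" using no no' region_exhaustive by blast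
  then have R: "regions X A \<subseteq> {Inn, InnThin, InnOut, OutThin, Out}" if "A \<subseteq> topspace X" for A
    using that by (rule regions_subset_if)
  have "k_space X \<in> {2, 4, 6, 8, 10} \<and> kf_space X \<in> {2, 4, 6, 8, 10, 12, 14, 16, 20}"
    by (rule space_counts[OF ne]) (use counts_by_regions(4)[OF _ ne R] in blast)+
  moreover have "4 \<le> k_space X \<and> 8 \<le> kf_space X"
    by (rule space_counts_ge[OF InnOut]) (use counts_bounds(4)[OF _ ne] in blast)
  ultimately show "k_space X \<in> {4, 6, 8, 10}" and "kf_space X \<in> {8, 10, 14, 16, 20}"
    using kf_space_not_12[OF ne] by auto
qed

lemma EO_counts:
  assumes ne: "topspace X \<noteq> {}" and T: "EO_space X"
  shows "k_space X \<in> {4, 6, 8}" and "kf_space X \<in> {4, 6, 8, 10, 16}"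
proof -
  have "BI \<in> type_set X" "IB \<in> type_set X" "B \<notin> type_set X" using T by (simp_all add: EO_space_def)
  then have no: "space_regions X \<inter> {InnOut, Mix, MixOut, Triple} = {}" and Thin: "OutThin \<in> space_regions X"
    using type_set_iff[of X] by auto
  then have "InnMix \<notin> space_regions X" using space_regions_cases(1)[OF ne] by blast
  then have "space_regions X \<subseteq> {Inn, InnThin, OutThin, Out}" using no region_exhaustive by blast
  then have R: "regions X A \<subseteq> {Inn, InnThin, OutThin, Out}" if "A \<subseteq> topspace X" for A
    using that by (rule regions_subset_if)
  have "k_space X \<in> {2, 4, 6, 8} \<and> kf_space X \<in> {2, 4, 6, 8, 10, 16}"
    by (rule space_counts[OF ne]) (use counts_by_regions(3)[OF _ ne R] in blast)+
  moreover have "4 \<le> k_space X \<and> 4 \<le> kf_space X"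
    by (rule space_counts_ge[OF Thin]) (use counts_bounds(3)[OF _ ne] in blast)
  ultimately show "k_space X \<in> {4, 6, 8}" and "kf_space X \<in> {4, 6, 8, 10, 16}" by auto
qed

lemma partition_counts:
  assumes ne: "topspace X \<noteq> {}" and T: "partition_space X"
  shows "k_space X \<in> {4, 6}" and "kf_space X \<in> {4, 6, 10}"
proof -
  have "IB \<in> type_set X" "B \<in> type_set X" "BI \<notin> type_set X" using T by (simp_all add: partition_space_def)
  then have no: "space_regions X \<inter> {InnOut, MixOut, Triple, OutThin} = {}" and Mix: "Mix \<in> space_regions X"
    using type_set_iff[of X] by auto
  then have "InnMix \<notin> space_regions X" "InnThin \<notin> space_regions X"
    using space_regions_cases(2,3)[OF ne] by blast+
  then have "space_regions X \<subseteq> {Inn, Mix, Out}" using no region_exhaustive by blast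
  then have R: "regions X A \<subseteq> {Inn, Mix, Out}" if "A \<subseteq> topspace X" for A
    using that by (rule regions_subset_if)
  have "k_space X \<in> {2, 4, 6} \<and> kf_space X \<in> {2, 4, 6, 10}"
    by (rule space_counts[OF ne]) (use counts_by_regions(2)[OF _ ne R] in blast)+
  moreover have "4 \<le> k_space X \<and> 4 \<le> kf_space X"
    by (rule space_counts_ge[OF Mix]) (use counts_bounds(3)[OF _ ne] in blast)
  ultimately show "k_space X \<in> {4, 6}" and "kf_space X \<in> {4, 6, 10}" by auto
qed

lemma discrete_counts:
  assumes ne: "topspace X \<noteq> {}" and T: "discrete_type_space X"
  shows "k_space X \<in> {2}" and "kf_space X \<in> {2, 4}"
proof -
  have "IB \<in> type_set X" "B \<in> type_set X" "BI \<in> type_set X" using T by (simp_all add: discrete_type_space_def)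
  then have no: "space_regions X \<inter> {InnOut, Mix, MixOut, Triple, OutThin} = {}"
    using type_set_iff[of X] by auto
  then have "InnMix \<notin> space_regions X" "InnThin \<notin> space_regions X"
    using space_regions_cases(2,3)[OF ne] by blast+
  then have "space_regions X \<subseteq> {Inn, Out}" using no region_exhaustive by blast
  then have R: "regions X A \<subseteq> {Inn, Out}" if "A \<subseteq> topspace X" for A
    using that by (rule regions_subset_if)
  have "k_space X \<in> {2} \<and> kf_space X \<in> {2, 4}"
    by (rule space_counts[OF ne]) (use counts_by_regions(1)[OF _ ne R] in blast)+
  then show "k_space X \<in> {2}" and "kf_space X \<in> {2, 4}" by auto
qed

section \<open>Finite spaces given by the closures of their points\<close>

definition closure_rows :: "bool list list \<Rightarrow> bool" where
  "closure_rows D \<longleftrightarrow> (\<forall>x<length D. length (D ! x) = length D \<and> D ! x ! x \<and>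
     (\<forall>y<length D. \<forall>z<length D. D ! x ! y \<longrightarrow> D ! y ! z \<longrightarrow> D ! x ! z))"

text \<open>
The entry \<open>D ! x ! y\<close> says that \<open>y\<close> is in the closure of \<open>x\<close>. So the open sets are those that contain with
\<open>y\<close> all points whose closures contain \<open>y\<close>.
\<close>

definition table_space :: "bool list list \<Rightarrow> nat topology" where
  "table_space D = topology (\<lambda>U. U \<subseteq> {..<length D} \<and>
     (\<forall>x<length D. \<forall>y<length D. D ! x ! y \<longrightarrow> y \<in> U \<longrightarrow> x \<in> U))"

lemma openin_table_space:
  "openin (table_space D) U \<longleftrightarrow> U \<subseteq> {..<length D} \<and>
     (\<forall>x<length D. \<forall>y<length D. D ! x ! y \<longrightarrow> y \<in> U \<longrightarrow> x \<in> U)"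
proof -
  have "istopology (\<lambda>U. U \<subseteq> {..<length D} \<and>
     (\<forall>x<length D. \<forall>y<length D. D ! x ! y \<longrightarrow> y \<in> U \<longrightarrow> x \<in> U))"
    unfolding istopology_def by blast
  then show ?thesis by (simp add: table_space_def topology_inverse')
qed

lemma topspace_table_space: "topspace (table_space D) = {..<length D}"
proof -
  have "openin (table_space D) {..<length D}" by (simp add: openin_table_space)
  moreover have "U \<subseteq> {..<length D}" if "openin (table_space D) U" for U
    using that by (simp add: openin_table_space)
  ultimately show ?thesis unfolding topspace_def by blast
qed

lemma closure_of_table_space:
  assumes D: "closure_rows D" and A: "A \<subseteq> {..<length D}"
  shows "table_space D closure_of A = {y. y < length D \<and> (\<exists>x\<in>A. D ! x ! y)}"
proof (intro set_eqI iffI)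
  fix y assume y: "y \<in> table_space D closure_of A"
  then have yn: "y < length D" by (simp add: in_closure_of topspace_table_space)
  let ?U = "{x. x < length D \<and> D ! x ! y}"
  have "openin (table_space D) ?U"
    using D yn unfolding openin_table_space closure_rows_def by blast
  moreover have "y \<in> ?U" using D yn by (simp add: closure_rows_def)
  moreover have "\<forall>T. y \<in> T \<and> openin (table_space D) T \<longrightarrow> (\<exists>x. x \<in> A \<and> x \<in> T)"
    using y unfolding in_closure_of by (rule conjunct2)
  ultimately obtain x where "x \<in> A" "x \<in> ?U" by (metis (no_types, lifting))
  then show "y \<in> {y. y < length D \<and> (\<exists>x\<in>A. D ! x ! y)}" using yn by blast
next
  fix y assume "y \<in> {y. y < length D \<and> (\<exists>x\<in>A. D ! x ! y)}"
  then obtain x where "y < length D" "x \<in> A" "D ! x ! y" by blast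
  moreover from this have "x < length D" using A by blast
  ultimately show "y \<in> table_space D closure_of A"
    by (auto simp: in_closure_of topspace_table_space openin_table_space)
qed

fun join :: "bool list \<Rightarrow> bool list \<Rightarrow> bool list" where
  "join (a # v) (b # w) = (a \<or> b) # join v w"
| "join _ _ = []"

text \<open>
The union of the rows of \<open>D\<close> selected by the second argument, starting from \<open>z\<close>.
\<close>

fun spread :: "bool list list \<Rightarrow> bool list \<Rightarrow> bool list \<Rightarrow> bool list" where
  "spread (r # D) (a # v) z = (if a then join r (spread D v z) else spread D v z)"
| "spread _ _ z = z"

lemma length_join: "length (join v w) = min (length v) (length w)"
  by (induction v w rule: join.induct) auto

lemma nth_join: "y < length v \<Longrightarrow> y < length w \<Longrightarrow> join v w ! y \<longleftrightarrow> v ! y \<or> w ! y"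
  by (induction v w arbitrary: y rule: join.induct) (auto simp: nth_Cons')

lemma spread_correct:
  assumes "\<forall>r\<in>set D. length r = length z" "length v = length D"
  shows "length (spread D v z) = length z \<and>
     (\<forall>y<length z. spread D v z ! y \<longleftrightarrow> z ! y \<or> (\<exists>x<length D. v ! x \<and> D ! x ! y))"
  using assms
proof (induction D v z rule: spread.induct)
  case (1 r D a v z)
  then have IH: "length (spread D v z) = length z"
    "\<And>y. y < length z \<Longrightarrow> spread D v z ! y \<longleftrightarrow> z ! y \<or> (\<exists>x<length D. v ! x \<and> D ! x ! y)"
    by (cases a; simp)+
  have "(\<exists>x<length (r # D). (a # v) ! x \<and> (r # D) ! x ! y) \<longleftrightarrow>
     a \<and> r ! y \<or> (\<exists>x<length D. v ! x \<and> D ! x ! y)" for y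
    by (simp add: Ex_less_Suc2)
  then show ?case using IH 1(3) by (auto simp: length_join nth_join)
qed auto

definition table_closure :: "bool list list \<Rightarrow> bool list \<Rightarrow> bool list" where
  "table_closure D v = spread D v (replicate (length D) False)"

definition table_interior :: "bool list list \<Rightarrow> bool list \<Rightarrow> bool list" where
  "table_interior D v = map Not (table_closure D (map Not v))"

definition members :: "bool list \<Rightarrow> nat set" where
  "members v = {x. x < length v \<and> v ! x}"

lemma members_table_closure:
  assumes D: "closure_rows D" and v: "length v = length D"
  shows "length (table_closure D v) = length D" "members (table_closure D v) = table_space D closure_of members v"
proof -
  have rows: "\<forall>r\<in>set D. length r = length (replicate (length D) False)"
    using D by (auto simp: closure_rows_def in_set_conv_nth)
  note S = spread_correct[OF rows v, folded table_closure_def]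
  show L: "length (table_closure D v) = length D" using S by simp
  have "members v \<subseteq> {..<length D}" using v by (auto simp: members_def)
  from closure_of_table_space[OF D this]
  show "members (table_closure D v) = table_space D closure_of members v"
    using S v by (auto simp: members_def)
qed

lemma members_Not:
  "length v = length D \<Longrightarrow> members (map Not v) = topspace (table_space D) - members v"
  by (auto simp: members_def topspace_table_space)

lemma members_table_interior:
  assumes D: "closure_rows D" and v: "length v = length D"
  shows "length (table_interior D v) = length D" "members (table_interior D v) = table_space D interior_of members v"
  using members_table_closure[OF D, of "map Not v"] v
  by (simp_all add: table_interior_def members_Not interior_of_closure_of)

lemma members_inject: "length v = length w \<Longrightarrow> members v = members w \<longleftrightarrow> v = w"
  by (auto simp: members_def list_eq_iff_nth_eq)

lemma range_members: "members ` {v. length v = n} = Pow {..<n}"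
proof
  show "Pow {..<n} \<subseteq> members ` {v. length v = n}"
  proof
    fix A assume "A \<in> Pow {..<n}"
    then have "A = members (map (\<lambda>x. x \<in> A) [0..<n])" by (auto simp: members_def)
    then show "A \<in> members ` {v. length v = n}" by (metis (mono_tags) imageI length_map length_upt mem_Collect_eq minus_nat.diff_0)
  qed
qed (auto simp: members_def)

definition point_region :: "bool \<times> bool \<times> bool \<times> bool \<times> bool \<times> bool \<times> bool \<Rightarrow> region" where
  "point_region = (\<lambda>(i, ibi, bi, ib, bu, bib, b).
     if i then Inn
     else if ibi then InnThin
     else if bi then (if ib then InnMix else if bu then Triple else InnOut)
     else if ib then Mix
     else if bib then MixOut
     else if b then OutThin
     else Out)"

fun list_diff :: "bool list \<Rightarrow> bool list \<Rightarrow> bool list" where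
  "list_diff (a # v) (b # w) = (a \<and> \<not> b) # list_diff v w"
| "list_diff _ _ = []"

lemma members_list_diff:
  "length v = length w \<Longrightarrow> length (list_diff v w) = length v \<and> members (list_diff v w) = members v - members w"
proof -
  assume "length v = length w"
  then have "length (list_diff v w) = length v \<and> (\<forall>y<length v. list_diff v w ! y \<longleftrightarrow> v ! y \<and> \<not> w ! y)"
    by (induction v w rule: list_induct2) (auto simp: nth_Cons')
  then show ?thesis using \<open>length v = length w\<close> by (auto simp: members_def)
qed

definition point_regions :: "bool list list \<Rightarrow> bool list \<Rightarrow> bool list \<Rightarrow> region list" where
  "point_regions D i b =
    (let bi = table_closure D i; ib = table_interior D b in
     map point_region (zip i (zip (table_interior D bi) (zip bi (zip ib
       (zip (table_closure D (list_diff ib bi)) (zip (table_closure D ib) b)))))))"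

lemma point_regions_correct:
  assumes D: "closure_rows D" and v: "length v = length D"
  shows "point_regions D (table_interior D v) (table_closure D v) = map (region_of (table_space D) (members v)) [0..<length D]"
proof -
  let ?X = "table_space D"
  define b i where "b = table_closure D v" and "i = table_interior D v"
  define bi ib where "bi = table_closure D i" and "ib = table_interior D b"
  define u where "u = list_diff ib bi"
  note C = members_table_closure[OF D] members_table_interior[OF D]
  have b: "length b = length D" "members b = ?X closure_of members v" using C v by (simp_all add: b_def)
  have i: "length i = length D" "members i = ?X interior_of members v" using C v by (simp_all add: i_def)
  have bi: "length bi = length D" "members bi = ?X closure_of members i" using C i by (simp_all add: bi_def)
  have ib: "length ib = length D" "members ib = ?X interior_of members b" using C b by (simp_all add: ib_def)
  have u: "length u = length D" "members u = members ib - members bi"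
    using members_list_diff[of ib bi] ib bi by (simp_all add: u_def)
  have ibi: "length (table_interior D bi) = length D" "members (table_interior D bi) = ?X interior_of members bi" using C bi by simp_all
  have bib: "length (table_closure D ib) = length D" "members (table_closure D ib) = ?X closure_of members ib" using C ib by simp_all
  have bu: "length (table_closure D u) = length D" "members (table_closure D u) = ?X closure_of members u" using C u by simp_all
  have mem: "w ! x \<longleftrightarrow> x \<in> members w" if "length w = length D" "x < length D" for w x
    using that by (simp add: members_def)
  have "point_regions D i b = map (region_of ?X (members v)) [0..<length D]"
  proof (rule nth_equalityI)
    show "length (point_regions D i b) = length (map (region_of ?X (members v)) [0..<length D])"
      using b(1) i(1) bi(1) ib(1) ibi(1) bib(1) bu(1)
      by (simp add: point_regions_def Let_def flip: bi_def ib_def u_def)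
    fix x assume "x < length (point_regions D i b)"
    then have x: "x < length D"
      using i(1) by (simp add: point_regions_def Let_def)
    have "point_regions D i b ! x = point_region (x \<in> members i, x \<in> members (table_interior D bi), x \<in> members bi,
        x \<in> members ib, x \<in> members (table_closure D u), x \<in> members (table_closure D ib), x \<in> members b)"
      using b(1) i(1) bi(1) ib(1) ibi(1) bib(1) bu(1) x
      by (simp add: point_regions_def Let_def mem flip: bi_def ib_def u_def)
    also have "\<dots> = region_of ?X (members v) x"
      unfolding region_of_def point_region_def Let_def prod.case
        ibi(2) bib(2) bu(2) u(2) bi(2) ib(2) i(2) b(2) ..
    finally show "point_regions D i b ! x = map (region_of ?X (members v)) [0..<length D] ! x"
      using x by simp
  qed
  then show ?thesis by (simp add: b_def i_def)
qed

definition verdict :: "region list \<Rightarrow> bool \<Rightarrow> region list \<times> nat \<times> nat" where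
  "verdict ns p = (ns, if p then tally ns else (fst (tally ns) + 2, snd (tally ns) + 2))"

text \<open>
The pattern of the subset \<open>v\<close> and its two counts, obtained from the table of counts. The subset is open or
closed if it is equal to its interior or to its closure.
\<close>

definition assess :: "bool list list \<Rightarrow> bool list \<Rightarrow> region list \<times> nat \<times> nat" where
  "assess D v = (let i = table_interior D v; b = table_closure D v; rs = point_regions D i b in
     verdict (filter (\<lambda>r. r \<in> set rs) all_regions) (i = v \<or> b = v))"

lemma assess_correct:
  assumes D: "closure_rows D" and ne: "D \<noteq> []" and v: "length v = length D"
  shows "assess D v = (pattern (table_space D) (members v),
     k_set (table_space D) (members v), kf_set (table_space D) (members v))"
proof -
  let ?X = "table_space D"
  have A: "members v \<subseteq> topspace ?X" using v by (auto simp: members_def topspace_table_space)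
  have X: "topspace ?X \<noteq> {}" using ne by (simp add: topspace_table_space lessThan_empty_iff)
  have "set (point_regions D (table_interior D v) (table_closure D v)) = regions ?X (members v)"
    by (simp add: point_regions_correct[OF D v] regions_def topspace_table_space atLeast0LessThan)
  then have p: "filter (\<lambda>r. r \<in> set (point_regions D (table_interior D v) (table_closure D v))) all_regions = pattern ?X (members v)"
    by (simp add: pattern_def)
  have "table_interior D v = v \<longleftrightarrow> openin ?X (members v)"
    using members_inject[of "table_interior D v" v] members_table_interior[OF D v] v by (simp add: interior_of_eq)
  moreover have "table_closure D v = v \<longleftrightarrow> closedin ?X (members v)"
    using members_inject[of "table_closure D v" v] members_table_closure[OF D v] v by (simp add: closure_of_eq)
  ultimately have "table_interior D v = v \<or> table_closure D v = v \<longleftrightarrow> open_or_closed ?X (members v)" by (simp add: open_or_closed_def)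
  then show ?thesis by (simp add: assess_def Let_def p verdict_def set_counts[OF A X])
qed

fun merge :: "region list \<times> nat \<times> nat \<Rightarrow> region list \<times> nat \<times> nat \<Rightarrow> region list \<times> nat \<times> nat" where
  "merge (ns, k, f) (ns', k', f') =
     (filter (\<lambda>r. r \<in> set ns \<or> r \<in> set ns') all_regions, max k k', max f f')"

text \<open>
Ranges over the vectors obtained from \<open>v\<close> by putting \<open>m\<close> entries in front of it. The recursion joins the
results of two halves at once, because a list of all subsets would be traversed again in every step of the
symbolic evaluation.
\<close>

fun survey :: "bool list list \<Rightarrow> nat \<Rightarrow> bool list \<Rightarrow> region list \<times> nat \<times> nat" where
  "survey D 0 v = assess D v"
| "survey D (Suc m) v = merge (survey D m (True # v)) (survey D m (False # v))"

definition extensions :: "nat \<Rightarrow> bool list \<Rightarrow> bool list set" where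
  "extensions m v = {w. length w = m + length v \<and> drop m w = v}"

lemma extensions_0: "extensions 0 v = {v}"
  by (auto simp: extensions_def)

lemma extensions_Suc: "extensions (Suc m) v = extensions m (True # v) \<union> extensions m (False # v)"
proof (rule set_eqI)
  fix w
  have "drop m w = True # v \<or> drop m w = False # v \<longleftrightarrow> drop (Suc m) w = v"
    if "length w = Suc (m + length v)"
  proof -
    have "drop m w = w ! m # drop (Suc m) w" using that by (intro Cons_nth_drop_Suc[symmetric]) simp
    then show ?thesis by (cases "w ! m") simp_all
  qed
  then show "w \<in> extensions (Suc m) v \<longleftrightarrow> w \<in> extensions m (True # v) \<union> extensions m (False # v)"
    by (auto simp: extensions_def)
qed

lemma survey_extensions:
  assumes "\<And>w. length w = m + length v \<Longrightarrow> assess D w = (N w, K w, F w)"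
  shows "finite (extensions m v) \<and> extensions m v \<noteq> {} \<and>
    (case survey D m v of (ns, k, f) \<Rightarrow>
      set ns = (\<Union>w\<in>extensions m v. set (N w)) \<and> k = Max (K ` extensions m v) \<and> f = Max (F ` extensions m v))"
  using assms
proof (induction m arbitrary: v)
  case 0
  then show ?case by (simp add: extensions_0)
next
  case (Suc m)
  have 1: "finite (extensions m (b # v)) \<and> extensions m (b # v) \<noteq> {} \<and>
    (case survey D m (b # v) of (ns, k, f) \<Rightarrow>
      set ns = (\<Union>w\<in>extensions m (b # v). set (N w)) \<and> k = Max (K ` extensions m (b # v)) \<and>
      f = Max (F ` extensions m (b # v)))" for b
    by (rule Suc.IH) (use Suc.prems in simp)
  obtain ns k f where s1: "survey D m (True # v) = (ns, k, f)" by (metis prod_cases3)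
  obtain ns' k' f' where s2: "survey D m (False # v) = (ns', k', f')" by (metis prod_cases3)
  have "set (filter (\<lambda>r. r \<in> set ns \<or> r \<in> set ns') all_regions) = set ns \<union> set ns'"
    using UNIV_region by auto
  then show ?case using 1[of True] 1[of False] by (simp add: extensions_Suc s1 s2 image_Un Max_Un)
qed

text \<open>
Transitivity is tested by comparing each row with its closure.
\<close>

definition closure_check :: "bool list list \<Rightarrow> bool" where
  "closure_check D \<longleftrightarrow> list_all (\<lambda>r. length r = length D \<and> table_closure D r = r) D \<and>
     list_all (\<lambda>x. D ! x ! x) [0..<length D]"

lemma closure_rows_if_check:
  assumes "closure_check D"
  shows "closure_rows D"
proof -
  have L: "length (D ! x) = length D" and T: "table_closure D (D ! x) = D ! x" and R: "D ! x ! x" if "x < length D" for x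
    using assms that by (auto simp: closure_check_def list_all_length)
  have rows: "\<forall>r\<in>set D. length r = length (replicate (length D) False)"
    using L by (metis in_set_conv_nth length_replicate)
  have "D ! x ! z" if x: "x < length D" and "y < length D" "z < length D" "D ! x ! y" "D ! y ! z" for x y z
  proof -
    have "\<forall>z<length D. table_closure D (D ! x) ! z \<longleftrightarrow> (\<exists>y<length D. D ! x ! y \<and> D ! y ! z)"
      using conjunct2[OF spread_correct[OF rows L[OF x]]] by (simp add: table_closure_def)
    then show ?thesis using that unfolding T[OF x] by blast
  qed
  then show ?thesis unfolding closure_rows_def using L R by blast
qed

lemma survey_correct:
  assumes D: "closure_check D" "D \<noteq> []" and s: "survey D (length D) [] = (ns, k, f)"
  shows "topspace (table_space D) \<noteq> {}" "space_regions (table_space D) = set ns"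
    "k_space (table_space D) = k" "kf_space (table_space D) = f"
proof -
  let ?X = "table_space D"
  have e: "extensions (length D) [] = {v. length v = length D}" by (auto simp: extensions_def)
  have P: "Pow (topspace ?X) = members ` {v. length v = length D}"
    by (simp only: topspace_table_space range_members)
  show "topspace ?X \<noteq> {}" using D(2) by (simp add: topspace_table_space lessThan_empty_iff)
  have "assess D w = (pattern ?X (members w), k_set ?X (members w), kf_set ?X (members w))"
    if "length w = length D + length []" for w :: "bool list"
    using assess_correct[OF closure_rows_if_check[OF D(1)] D(2)] that by simp
  then have "case survey D (length D) [] of (ns, k, f) \<Rightarrow>
      set ns = (\<Union>w\<in>extensions (length D) []. set (pattern ?X (members w))) \<and>
      k = Max ((\<lambda>w. k_set ?X (members w)) ` extensions (length D) []) \<and>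
      f = Max ((\<lambda>w. kf_set ?X (members w)) ` extensions (length D) [])"
    by (intro survey_extensions[THEN conjunct2, THEN conjunct2])
  then show "space_regions ?X = set ns" "k_space ?X = k" "kf_space ?X = f"
    by (simp_all only: space_regions_def k_space_def kf_space_def P e s prod.case set_pattern image_image)
qed

section \<open>Attaining spaces\<close>

definition table :: "nat list list \<Rightarrow> bool list list" where
  "table Rs = map (\<lambda>r. map (\<lambda>y. y \<in> set r) [0..<length Rs]) Rs"

text \<open>
The first three flags stand for the membership of \<open>IB\<close>, \<open>BI\<close> and \<open>B\<close> in the type of the space, the last one
says that all mixed parts are clopen.
\<close>

definition type_flags :: "region set \<Rightarrow> bool \<times> bool \<times> bool \<times> bool" where
  "type_flags N =
     (\<not> (InnOut \<in> N \<or> MixOut \<in> N \<or> Triple \<in> N), \<not> (Mix \<in> N \<or> MixOut \<in> N), OutThin \<notin> N,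
      \<not> (InnMix \<in> N \<or> MixOut \<in> N \<or> Triple \<in> N))"

lemma type_flags_space:
  shows "type_flags (space_regions X) = (False, False, False, False) \<Longrightarrow> GE_space X"
    and "type_flags (space_regions X) = (False, False, False, True) \<Longrightarrow> KD_space X"
    and "type_flags (space_regions X) = (True, False, False, True) \<Longrightarrow> ED_space X"
    and "type_flags (space_regions X) = (False, True, False, True) \<Longrightarrow> OU_space X"
    and "type_flags (space_regions X) = (True, True, False, True) \<Longrightarrow> EO_space X"
    and "type_flags (space_regions X) = (True, False, True, True) \<Longrightarrow> partition_space X"
    and "type_flags (space_regions X) = (True, True, True, True) \<Longrightarrow> discrete_type_space X"
proof -
  have flags: "type_flags (space_regions X) = (IB \<in> type_set X, BI \<in> type_set X, B \<in> type_set X,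
      space_regions X \<inter> {InnMix, MixOut, Triple} = {})"
    by (simp add: type_flags_def type_set_iff)
  have T: "type_set X = (if IB \<in> type_set X then {IB} else {}) \<union> (if BI \<in> type_set X then {BI} else {}) \<union>
      (if B \<in> type_set X then {B} else {})"
  proof (rule set_eqI)
    fix w show "w \<in> type_set X \<longleftrightarrow> w \<in> (if IB \<in> type_set X then {IB} else {}) \<union>
        (if BI \<in> type_set X then {BI} else {}) \<union> (if B \<in> type_set X then {B} else {})"
      by (cases w) simp_all
  qed
  show "type_flags (space_regions X) = (False, False, False, False) \<Longrightarrow> GE_space X"
    "type_flags (space_regions X) = (False, False, False, True) \<Longrightarrow> KD_space X"
    unfolding flags GE_space_def KD_space_iff kuratowski_space_def by (subst T, simp)+
  show "type_flags (space_regions X) = (True, False, False, True) \<Longrightarrow> ED_space X"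
    "type_flags (space_regions X) = (False, True, False, True) \<Longrightarrow> OU_space X"
    "type_flags (space_regions X) = (True, True, False, True) \<Longrightarrow> EO_space X"
    "type_flags (space_regions X) = (True, False, True, True) \<Longrightarrow> partition_space X"
    "type_flags (space_regions X) = (True, True, True, True) \<Longrightarrow> discrete_type_space X"
    unfolding flags ED_space_def OU_space_def EO_space_def partition_space_def discrete_type_space_def
    by (subst T, simp add: insert_commute)+
qed

text \<open>
The row for the point \<open>x\<close> lists the points in the closure of \<open>x\<close>.
\<close>

definition realizes :: "nat list list \<Rightarrow> bool \<times> bool \<times> bool \<times> bool \<Rightarrow> nat \<Rightarrow> nat \<Rightarrow> bool" where
  "realizes Rs fl k f \<longleftrightarrow> Rs \<noteq> [] \<and> closure_check (table Rs) \<and>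
     (case survey (table Rs) (length Rs) [] of (ns, k', f') \<Rightarrow>
        type_flags (set ns) = fl \<and> k' = k \<and> f' = f)"

lemma realizes_values:
  assumes "realizes Rs fl k f" and P: "\<And>X :: nat topology. type_flags (space_regions X) = fl \<Longrightarrow> P X"
  shows "k \<in> k_values TYPE(nat) P" and "f \<in> kf_values TYPE(nat) P"
proof -
  let ?D = "table Rs"
  have L: "length ?D = length Rs" by (simp add: table_def)
  obtain ns where s: "survey ?D (length ?D) [] = (ns, k, f)" and fl: "type_flags (set ns) = fl"
    using assms(1) L by (auto simp: realizes_def)
  have D: "closure_check ?D" "?D \<noteq> []" using assms(1) by (auto simp: realizes_def table_def)
  note S = survey_correct[OF D s]
  have "P (table_space ?D)" using P fl S(2) by simp
  then show "k \<in> k_values TYPE(nat) P" "f \<in> kf_values TYPE(nat) P"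
    using S unfolding k_values_def kf_values_def by (metis (mono_tags, lifting) mem_Collect_eq)+
qed

lemma GE_examples:
  shows "realizes [[0], [0, 1, 2], [0, 1, 2], [0, 3]] (False, False, False, False) 8 10"
    and "realizes [[0], [1], [0, 2], [0, 1, 3, 4], [0, 1, 3, 4]] (False, False, False, False) 8 14"
    and "realizes [[0], [1], [0, 2, 3], [0, 2, 3], [0, 4]] (False, False, False, False) 8 16"
    and "realizes [[0], [0, 1, 2], [0, 1, 2], [0, 3], [0, 4]] (False, False, False, False) 10 18"
    and "realizes [[0], [1], [2], [0, 1, 3, 4], [0, 1, 3, 4], [0, 2, 5]] (False, False, False, False) 10 20"
    and "realizes [[0], [1], [2], [0, 3, 4], [0, 3, 4], [0, 1, 5]] (False, False, False, False) 10 22"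
    and "realizes [[0], [1], [0, 2, 3], [0, 2, 3], [0, 4], [0, 1, 5]] (False, False, False, False) 12 24"
    and "realizes [[0], [1], [2], [0, 1, 3, 4], [0, 1, 3, 4], [0, 2, 5], [1, 2, 6]] (False, False, False, False) 10 26"
    and "realizes [[0], [1], [2], [0, 3, 4], [0, 3, 4], [1, 5], [0, 2, 6]] (False, False, False, False) 12 28"
    and "realizes [[0], [1], [2], [0, 3, 4], [0, 3, 4], [0, 1, 5], [0, 2, 6]] (False, False, False, False) 14 30"
  by code_simp+

lemma GE_example_32:
  "realizes [[0], [1], [2], [3], [0, 4, 5], [0, 4, 5], [0, 1, 2, 6], [0, 1, 3, 7]] (False, False, False, False) 14 32"
  by code_simp

lemma GE_example_34:
  "realizes [[0], [1], [2], [3], [0, 4, 5], [0, 4, 5], [1, 2, 6], [0, 1, 3, 7]] (False, False, False, False) 14 34"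
  by code_simp

lemma GE_attained:
  shows "{8, 10, 12, 14} \<subseteq> k_values TYPE(nat) GE_space"
    and "{10} \<union> {14, 16, 18, 20, 22, 24, 26, 28, 30, 32, 34} \<subseteq> kf_values TYPE(nat) GE_space"
proof -
  note E = GE_examples GE_example_32 GE_example_34
  note V = realizes_values[where P = GE_space, OF _ type_flags_space(1)]
  show "{8, 10, 12, 14} \<subseteq> k_values TYPE(nat) GE_space"
    and "{10} \<union> {14, 16, 18, 20, 22, 24, 26, 28, 30, 32, 34} \<subseteq> kf_values TYPE(nat) GE_space"
    using E[THEN V(1)] E[THEN V(2)]
    by simp_all
qed

lemma KD_examples:
  shows "realizes [[0], [1, 2], [1, 2], [0, 3], [0, 4]] (False, False, False, True) 10 18"
    and "realizes [[0], [1], [2, 3], [2, 3], [0, 4], [0, 1, 5]] (False, False, False, True) 12 22"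
    and "realizes [[0], [1], [2], [3, 4], [3, 4], [0, 1, 5], [0, 2, 6]] (False, False, False, True) 14 28"
  by code_simp+

lemma KD_attained:
  shows "{10, 12, 14} \<subseteq> k_values TYPE(nat) KD_space"
    and "{18, 22, 28} \<subseteq> kf_values TYPE(nat) KD_space"
proof -
  note E = KD_examples
  note V = realizes_values[where P = KD_space, OF _ type_flags_space(2)]
  show "{10, 12, 14} \<subseteq> k_values TYPE(nat) KD_space"
    and "{18, 22, 28} \<subseteq> kf_values TYPE(nat) KD_space"
    using E[THEN V(1)] E[THEN V(2)]
    by simp_all
qed

lemma ED_examples:
  shows "realizes [[0], [0, 1, 2], [0, 1, 2]] (True, False, False, True) 4 4"
    and "realizes [[0, 1], [0, 1], [0, 1, 2, 3], [0, 1, 2, 3]] (True, False, False, True) 6 6"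
    and "realizes [[0], [1], [0, 2, 3], [0, 2, 3]] (True, False, False, True) 6 8"
    and "realizes [[0], [1, 2], [1, 2], [0, 3]] (True, False, False, True) 8 10"
    and "realizes [[0], [1, 2], [1, 2], [3], [0, 4]] (True, False, False, True) 8 16"
    and "realizes [[0], [1], [2, 3], [2, 3], [0, 4], [1, 5]] (True, False, False, True) 10 22"
  by code_simp+

lemma ED_attained:
  shows "{4, 6, 8, 10} \<subseteq> k_values TYPE(nat) ED_space"
    and "{4, 6, 8, 10, 16, 22} \<subseteq> kf_values TYPE(nat) ED_space"
proof -
  note E = ED_examples
  note V = realizes_values[where P = ED_space, OF _ type_flags_space(3)]
  show "{4, 6, 8, 10} \<subseteq> k_values TYPE(nat) ED_space"
    and "{4, 6, 8, 10, 16, 22} \<subseteq> kf_values TYPE(nat) ED_space"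
    using E[THEN V(1)] E[THEN V(2)]
    by simp_all
qed

lemma OU_examples:
  shows "realizes [[0], [0, 1], [0, 2]] (False, True, False, True) 4 8"
    and "realizes [[0, 1], [0, 1], [0, 1, 2], [0, 1, 3]] (False, True, False, True) 6 10"
    and "realizes [[0], [1], [0, 2], [0, 1, 3]] (False, True, False, True) 8 14"
    and "realizes [[0], [1], [0, 2], [0, 3], [1, 4]] (False, True, False, True) 8 16"
    and "realizes [[0], [1], [2], [0, 1, 3], [0, 2, 4]] (False, True, False, True) 10 20"
  by code_simp+

lemma OU_attained:
  shows "{4, 6, 8, 10} \<subseteq> k_values TYPE(nat) OU_space"
    and "{8, 10, 14, 16, 20} \<subseteq> kf_values TYPE(nat) OU_space"
proof -
  note E = OU_examples
  note V = realizes_values[where P = OU_space, OF _ type_flags_space(4)]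
  show "{4, 6, 8, 10} \<subseteq> k_values TYPE(nat) OU_space"
    and "{8, 10, 14, 16, 20} \<subseteq> kf_values TYPE(nat) OU_space"
    using E[THEN V(1)] E[THEN V(2)]
    by simp_all
qed

lemma EO_examples:
  shows "realizes [[0], [0, 1]] (True, True, False, True) 4 4"
    and "realizes [[0, 1], [0, 1], [0, 1, 2]] (True, True, False, True) 6 6"
    and "realizes [[0], [1], [0, 2]] (True, True, False, True) 4 8"
    and "realizes [[0, 1], [0, 1], [2], [0, 1, 3]] (True, True, False, True) 6 10"
    and "realizes [[0], [1], [0, 2], [1, 3]] (True, True, False, True) 8 16"
  by code_simp+

lemma EO_attained:
  shows "{4, 6, 8} \<subseteq> k_values TYPE(nat) EO_space"
    and "{4, 6, 8, 10, 16} \<subseteq> kf_values TYPE(nat) EO_space"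
proof -
  note E = EO_examples
  note V = realizes_values[where P = EO_space, OF _ type_flags_space(5)]
  show "{4, 6, 8} \<subseteq> k_values TYPE(nat) EO_space"
    and "{4, 6, 8, 10, 16} \<subseteq> kf_values TYPE(nat) EO_space"
    using E[THEN V(1)] E[THEN V(2)]
    by simp_all
qed

lemma partition_examples:
  shows "realizes [[0, 1], [0, 1]] (True, False, True, True) 4 4"
    and "realizes [[0, 1], [0, 1], [2]] (True, False, True, True) 6 6"
    and "realizes [[0, 1], [0, 1], [2], [3]] (True, False, True, True) 6 10"
  by code_simp+

lemma partition_attained:
  shows "{4, 6} \<subseteq> k_values TYPE(nat) partition_space"
    and "{4, 6, 10} \<subseteq> kf_values TYPE(nat) partition_space"
proof -
  note E = partition_examples
  note V = realizes_values[where P = partition_space, OF _ type_flags_space(6)]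
  show "{4, 6} \<subseteq> k_values TYPE(nat) partition_space"
    and "{4, 6, 10} \<subseteq> kf_values TYPE(nat) partition_space"
    using E[THEN V(1)] E[THEN V(2)]
    by simp_all
qed

lemma discrete_examples:
  shows "realizes [[0]] (True, True, True, True) 2 2"
    and "realizes [[0], [1]] (True, True, True, True) 2 4"
  by code_simp+

lemma discrete_attained:
  shows "{2} \<subseteq> k_values TYPE(nat) discrete_type_space"
    and "{2, 4} \<subseteq> kf_values TYPE(nat) discrete_type_space"
proof -
  note E = discrete_examples
  note V = realizes_values[where P = discrete_type_space, OF _ type_flags_space(7)]
  show "{2} \<subseteq> k_values TYPE(nat) discrete_type_space"
    and "{2, 4} \<subseteq> kf_values TYPE(nat) discrete_type_space"
    using E[THEN V(1)] E[THEN V(2)]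
    by simp_all
qed

section \<open>The sets of values\<close>

lemma k_values_subset:
  assumes "\<And>X :: 'a topology. topspace X \<noteq> {} \<Longrightarrow> P X \<Longrightarrow> k_space X \<in> S"
  shows "k_values TYPE('a) P \<subseteq> S"
  unfolding k_values_def using assms by blast

lemma kf_values_subset:
  assumes "\<And>X :: 'a topology. topspace X \<noteq> {} \<Longrightarrow> P X \<Longrightarrow> kf_space X \<in> S"
  shows "kf_values TYPE('a) P \<subseteq> S"
  unfolding kf_values_def using assms by blast

lemma GE_bounded:
  "k_values TYPE('a) GE_space \<subseteq> {8, 10, 12, 14}"
  "kf_values TYPE('a) GE_space \<subseteq> {10} \<union> {14, 16, 18, 20, 22, 24, 26, 28, 30, 32, 34}"
  by (rule k_values_subset kf_values_subset, rule GE_counts, assumption+)+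

lemma KD_bounded:
  "k_values TYPE('a) KD_space \<subseteq> {10, 12, 14}"
  "kf_values TYPE('a) KD_space \<subseteq> {18, 22, 28}"
  by (rule k_values_subset kf_values_subset, rule KD_counts, assumption+)+

lemma ED_bounded:
  "k_values TYPE('a) ED_space \<subseteq> {4, 6, 8, 10}"
  "kf_values TYPE('a) ED_space \<subseteq> {4, 6, 8, 10, 16, 22}"
  by (rule k_values_subset kf_values_subset, rule ED_counts, assumption+)+

lemma OU_bounded:
  "k_values TYPE('a) OU_space \<subseteq> {4, 6, 8, 10}"
  "kf_values TYPE('a) OU_space \<subseteq> {8, 10, 14, 16, 20}"
  by (rule k_values_subset kf_values_subset, rule OU_counts, assumption+)+

lemma EO_bounded:
  "k_values TYPE('a) EO_space \<subseteq> {4, 6, 8}"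
  "kf_values TYPE('a) EO_space \<subseteq> {4, 6, 8, 10, 16}"
  by (rule k_values_subset kf_values_subset, rule EO_counts, assumption+)+

lemma partition_bounded:
  "k_values TYPE('a) partition_space \<subseteq> {4, 6}"
  "kf_values TYPE('a) partition_space \<subseteq> {4, 6, 10}"
  by (rule k_values_subset kf_values_subset, rule partition_counts, assumption+)+

lemma discrete_bounded:
  "k_values TYPE('a) discrete_type_space \<subseteq> {2}"
  "kf_values TYPE('a) discrete_type_space \<subseteq> {2, 4}"
  by (rule k_values_subset kf_values_subset, rule discrete_counts, assumption+)+

(* The inclusions range over all spaces on an arbitrary point type 'a; a statement cannot quantify
   existentially over types, so the attaining spaces are taken on the point type nat. *)
theorem theorem10:
  shows
    "k_values TYPE(nat) GE_space = {8, 10, 12, 14} \<and>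
     k_values TYPE('a) GE_space \<subseteq> {8, 10, 12, 14} \<and>
     kf_values TYPE(nat) GE_space = {10} \<union> {14, 16, 18, 20, 22, 24, 26, 28, 30, 32, 34} \<and>
     kf_values TYPE('a) GE_space \<subseteq> {10} \<union> {14, 16, 18, 20, 22, 24, 26, 28, 30, 32, 34} \<and>
     k_values TYPE(nat) KD_space = {10, 12, 14} \<and>
     k_values TYPE('a) KD_space \<subseteq> {10, 12, 14} \<and>
     kf_values TYPE(nat) KD_space = {18, 22, 28} \<and>
     kf_values TYPE('a) KD_space \<subseteq> {18, 22, 28} \<and>
     k_values TYPE(nat) ED_space = {4, 6, 8, 10} \<and>
     k_values TYPE('a) ED_space \<subseteq> {4, 6, 8, 10} \<and>
     kf_values TYPE(nat) ED_space = {4, 6, 8, 10, 16, 22} \<and>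
     kf_values TYPE('a) ED_space \<subseteq> {4, 6, 8, 10, 16, 22} \<and>
     k_values TYPE(nat) OU_space = {4, 6, 8, 10} \<and>
     k_values TYPE('a) OU_space \<subseteq> {4, 6, 8, 10} \<and>
     kf_values TYPE(nat) OU_space = {8, 10, 14, 16, 20} \<and>
     kf_values TYPE('a) OU_space \<subseteq> {8, 10, 14, 16, 20} \<and>
     k_values TYPE(nat) EO_space = {4, 6, 8} \<and>
     k_values TYPE('a) EO_space \<subseteq> {4, 6, 8} \<and>
     kf_values TYPE(nat) EO_space = {4, 6, 8, 10, 16} \<and>
     kf_values TYPE('a) EO_space \<subseteq> {4, 6, 8, 10, 16} \<and>
     k_values TYPE(nat) partition_space = {4, 6} \<and>
     k_values TYPE('a) partition_space \<subseteq> {4, 6} \<and>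
     kf_values TYPE(nat) partition_space = {4, 6, 10} \<and>
     kf_values TYPE('a) partition_space \<subseteq> {4, 6, 10} \<and>
     k_values TYPE(nat) discrete_type_space = {2} \<and>
     k_values TYPE('a) discrete_type_space \<subseteq> {2} \<and>
     kf_values TYPE(nat) discrete_type_space = {2, 4} \<and>
     kf_values TYPE('a) discrete_type_space \<subseteq> {2, 4}"
  by (intro conjI subset_antisym; (rule GE_bounded GE_attained KD_bounded KD_attained ED_bounded ED_attained
    OU_bounded OU_attained EO_bounded EO_attained partition_bounded partition_attained discrete_bounded discrete_attained))

end
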